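(* Let $G$ be an abstract group. The following are equivalent: (1) $G$ is left circularly orderable; (2) the discrete topological group $(G,\tau_{discr})$ is c-orderly.
   Context: A circular order on a set $X$ is a ternary relation $R\subset X^3$ (write $[a,b,c]$ for $(a,b,c)\in R$) such that: (Cyclicity) $[a,b,c]\Rightarrow[b,c,a]$; (Asymmetry) $[a,b,c]\Rightarrow (b,a,c)\notin R$; (Transitivity) $[a,b,c]$ and $[a,c,d]$ imply $[a,b,d]$; (Totality) if $a,b,c$ are distinct then $[a,b,c]$ or $[a,c,b]$. For $a,b\in X$ put $(a,b)_\circ=\{x: [a,x,b]\}$ and $[a,b]_\circ=(a,b)_\circ\cup\{a,b\}$. The circular topology on $X$ is the (Hausdorff) topology with base $\{X\setminus[a,b]_\circ: a,b\in X\}\cup\{X\}$. A compact circularly ordered space is a circularly ordered set whose circular topology is compact, equipped with that topology. A group $G$ is left circularly orderable if there is a circular order on the set $G$ such that $[x,y,z]\Leftrightarrow[gx,gy,gz]$ for all $g,x,y,z\in G$. For a compact circularly ordered space $K$, $H_+(K)$ is the group of all homeomorphisms $g\colon K\to K$ preserving the circular order ($[x,y,z]\Leftrightarrow[gx,gy,gz]$), with the compact-open topology. A topological group $G$ is c-orderly if it embeds as a topological group (injective homomorphism that is a homeomorphism onto its image) into $H_+(K)$ for some compact circularly ordered space $K$. $\tau_{discr}$ denotes the discrete topology. *)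

theory Defs
  imports "HOL-Analysis.Analysis" "HOL-Algebra.Bij"
begin

definition circular_order :: "'a set \<Rightarrow> ('a \<times> 'a \<times> 'a) set \<Rightarrow> bool" where
  "circular_order X R \<longleftrightarrow>
     R \<subseteq> X \<times> X \<times> X \<and>
     (\<forall>a b c. (a, b, c) \<in> R \<longrightarrow> (b, c, a) \<in> R) \<and>
     (\<forall>a b c. (a, b, c) \<in> R \<longrightarrow> (b, a, c) \<notin> R) \<and>
     (\<forall>a b c d. (a, b, c) \<in> R \<and> (a, c, d) \<in> R \<longrightarrow> (a, b, d) \<in> R) \<and>
     (\<forall>a\<in>X. \<forall>b\<in>X. \<forall>c\<in>X. a \<noteq> b \<and> b \<noteq> c \<and> a \<noteq> c \<longrightarrow> (a, b, c) \<in> R \<or> (a, c, b) \<in> R)"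

definition left_circularly_orderable :: "('a, 'b) monoid_scheme \<Rightarrow> bool" where
  "left_circularly_orderable G \<longleftrightarrow>
     (\<exists>R. circular_order (carrier G) R \<and>
        (\<forall>g\<in>carrier G. \<forall>x\<in>carrier G. \<forall>y\<in>carrier G. \<forall>z\<in>carrier G.
           (x, y, z) \<in> R \<longleftrightarrow> (g \<otimes>\<^bsub>G\<^esub> x, g \<otimes>\<^bsub>G\<^esub> y, g \<otimes>\<^bsub>G\<^esub> z) \<in> R))"

definition open_arc :: "('a \<times> 'a \<times> 'a) set \<Rightarrow> 'a \<Rightarrow> 'a \<Rightarrow> 'a set" where
  "open_arc R a b = {x. (a, x, b) \<in> R}"

definition closed_arc :: "('a \<times> 'a \<times> 'a) set \<Rightarrow> 'a \<Rightarrow> 'a \<Rightarrow> 'a set" where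
  "closed_arc R a b = open_arc R a b \<union> {a, b}"

definition circular_base :: "'a set \<Rightarrow> ('a \<times> 'a \<times> 'a) set \<Rightarrow> 'a set set" where
  "circular_base X R = {X - closed_arc R a b | a b. a \<in> X \<and> b \<in> X} \<union> {X}"

text \<open>\<open>topology_generated_by\<close> takes a subbase; the lemma \<open>openin_circular_topology_iff\<close>
  below shows that for a circular order the generating family is in fact a base.\<close>

definition circular_topology :: "'a set \<Rightarrow> ('a \<times> 'a \<times> 'a) set \<Rightarrow> 'a topology" where
  "circular_topology X R = topology_generated_by (circular_base X R)"

lemma topspace_circular_topology [simp]: "topspace (circular_topology X R) = X"
  by (auto simp: circular_topology_def circular_base_def)

lemma circular_base_Int:
  assumes R: "circular_order X R"
    and U: "U \<in> circular_base X R" and V: "V \<in> circular_base X R"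
    and x: "x \<in> U \<inter> V"
  shows "\<exists>W\<in>circular_base X R. x \<in> W \<and> W \<subseteq> U \<inter> V"
proof (cases "U = X \<or> V = X")
  case True
  moreover have "U \<subseteq> X" "V \<subseteq> X" using U V by (auto simp: circular_base_def)
  ultimately show ?thesis using U V x by blast
next
  case False
  obtain a b where ab: "a \<in> X" "b \<in> X" "U = X - closed_arc R a b"
    using U False by (auto simp: circular_base_def)
  obtain c d where cd: "c \<in> X" "d \<in> X" "V = X - closed_arc R c d"
    using V False by (auto simp: circular_base_def)
  note ax = R[unfolded circular_order_def]
  have cyc: "(q, r, p) \<in> R" if "(p, q, r) \<in> R" for p q r
    using ax[THEN conjunct2, THEN conjunct1, rule_format, OF that] .
  have asym: "(q, p, r) \<notin> R" if "(p, q, r) \<in> R" for p q r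
    using ax[THEN conjunct2, THEN conjunct2, THEN conjunct1, rule_format, OF that] .
  have trans: "(p, q, s) \<in> R" if "(p, q, r) \<in> R" "(p, r, s) \<in> R" for p q r s
    using ax[THEN conjunct2, THEN conjunct2, THEN conjunct2, THEN conjunct1, rule_format,
        OF conjI, OF that] .
  have tot: "(p, q, r) \<in> R \<or> (p, r, q) \<in> R"
    if "p \<in> X" "q \<in> X" "r \<in> X" "p \<noteq> q" "q \<noteq> r" "p \<noteq> r" for p q r
    using ax[THEN conjunct2, THEN conjunct2, THEN conjunct2, THEN conjunct2] that by simp
  define le where "le p q \<longleftrightarrow> p = q \<or> (x, p, q) \<in> R" for p q
  have xX: "x \<in> X" using x ab by auto
  have le_trans: "le p r" if "le p q" "le q r" for p q r
    using that trans[of x p q r] unfolding le_def by auto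
  have le_tot: "le p q \<or> le q p" if "p \<in> X" "q \<in> X" "p \<noteq> x" "q \<noteq> x" for p q
    using that tot[of x p q] xX unfolding le_def by auto
  have dist: "p \<noteq> q" "q \<noteq> r" "p \<noteq> r" if "(p, q, r) \<in> R" for p q r
    using that asym[of p q r] cyc[of p q r] asym[of q r p] cyc[of q r p] asym[of r p q] by auto
  have arc_le: "le p q" if "x \<notin> closed_arc R p q" "p \<in> X" "q \<in> X" for p q
    using that tot[of x p q] xX cyc[of x q p] cyc[of q p x]
    unfolding le_def closed_arc_def open_arc_def by auto
  have le_arc: "y \<in> closed_arc R p q \<longleftrightarrow> le p y \<and> le y q"
    if pq: "le p q" "p \<in> X" "q \<in> X" "p \<noteq> x" "q \<noteq> x" and y: "y \<noteq> x" for p q y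
  proof
    assume "y \<in> closed_arc R p q"
    then consider "y = p" | "y = q" | "(p, y, q) \<in> R" "y \<noteq> p" "y \<noteq> q"
      unfolding closed_arc_def open_arc_def by blast
    then show "le p y \<and> le y q"
    proof cases
      case 3
      have "p \<noteq> q" using dist(3)[OF 3(1)] .
      then have xpq: "(x, p, q) \<in> R" using pq unfolding le_def by simp
      have "(q, x, y) \<in> R"
        by (rule trans[OF cyc[OF cyc[OF xpq]] cyc[OF cyc[OF 3(1)]]])
      moreover have "(p, y, x) \<in> R"
        by (rule trans[OF 3(1) cyc[OF xpq]])
      ultimately show ?thesis using cyc[of q x y] cyc[of p y x] cyc[of y x p] unfolding le_def by simp
    qed (use pq le_def in auto)
  next
    assume A: "le p y \<and> le y q"
    show "y \<in> closed_arc R p q"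
    proof (cases "y = p \<or> y = q")
      case False
      then have "(x, p, y) \<in> R" "(x, y, q) \<in> R" using A unfolding le_def by auto
      then have "(y, q, p) \<in> R" using trans[of y q x p] cyc[of x p y] cyc[of p y x] cyc[of x y q] by simp
      then show ?thesis using cyc[of y q p] cyc[of q p y] unfolding closed_arc_def open_arc_def by simp
    qed (auto simp: closed_arc_def)
  qed
  have ne: "a \<noteq> x" "b \<noteq> x" "c \<noteq> x" "d \<noteq> x"
    using x ab cd unfolding closed_arc_def by auto
  have lab: "le a b" and lcd: "le c d" using arc_le x ab cd by auto
  obtain p where p: "p \<in> X" "p \<noteq> x" "le p a" "le p c"
    using le_tot[OF ab(1) cd(1) ne(1,3)] ab(1) cd(1) ne le_def by metis
  obtain q where q: "q \<in> X" "q \<noteq> x" "le b q" "le d q"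
    using le_tot[OF ab(2) cd(2) ne(2,4)] ab(2) cd(2) ne le_def by metis
  have lpq: "le p q" using le_trans[OF le_trans[OF p(3) lab] q(3)] .
  have "x \<notin> closed_arc R p q"
  proof
    assume "x \<in> closed_arc R p q"
    then have "(p, x, q) \<in> R" using p q unfolding closed_arc_def open_arc_def by auto
    then show False using lpq asym[of p x q] dist(3)[of p x q] unfolding le_def by simp
  qed
  moreover have "X - closed_arc R p q \<subseteq> U \<inter> V"
  proof
    fix y assume y: "y \<in> X - closed_arc R p q"
    show "y \<in> U \<inter> V"
    proof (cases "y = x")
      case False
      have "\<not> (le p y \<and> le y q)" using le_arc[OF lpq p(1) q(1) p(2) q(2) False] y by simp
      then have "\<not> (le a y \<and> le y b)" "\<not> (le c y \<and> le y d)"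
        using le_trans[OF p(3), of y] le_trans[OF p(4), of y] le_trans[OF _ q(3), of y]
          le_trans[OF _ q(4), of y] by auto
      then show ?thesis
        using le_arc[OF lab ab(1,2) ne(1,2) False] le_arc[OF lcd cd(1,2) ne(3,4) False]
          ab(3) cd(3) y by simp
    qed (use x in blast)
  qed
  moreover have "X - closed_arc R p q \<in> circular_base X R"
    using p q unfolding circular_base_def by auto
  ultimately show ?thesis using xX by (intro bexI[of _ "X - closed_arc R p q"]) auto
qed

lemma openin_circular_topology_iff:
  assumes R: "circular_order X R"
  shows "openin (circular_topology X R) U \<longleftrightarrow> (\<exists>\<B>\<subseteq>circular_base X R. U = \<Union>\<B>)"
proof
  assume "openin (circular_topology X R) U"
  then have "generate_topology_on (circular_base X R) U"
    unfolding circular_topology_def by (rule openin_topology_generated_by)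
  then have nb: "\<exists>W\<in>circular_base X R. x \<in> W \<and> W \<subseteq> U" if "x \<in> U" for x
    using that
  proof (induction arbitrary: x rule: generate_topology_on.induct)
    case (Int S T)
    then obtain V W where VW: "V \<in> circular_base X R" "x \<in> V" "V \<subseteq> S"
        "W \<in> circular_base X R" "x \<in> W" "W \<subseteq> T"
      by (meson IntD1 IntD2)
    then obtain Z where "Z \<in> circular_base X R" "x \<in> Z" "Z \<subseteq> V \<inter> W"
      using circular_base_Int[OF R, of V W x] by auto
    then show ?case using VW by (intro bexI[of _ Z]) auto
  next
    case (UN \<K>)
    then obtain S where "S \<in> \<K>" "x \<in> S" by auto
    with UN.IH[of S x] show ?case by (meson Union_upper subset_trans)
  qed auto
  have "U = \<Union>{W \<in> circular_base X R. W \<subseteq> U}"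
    using nb by auto
  then show "\<exists>\<B>\<subseteq>circular_base X R. U = \<Union>\<B>"
    by (intro exI[of _ "{W \<in> circular_base X R. W \<subseteq> U}"]) simp
next
  assume "\<exists>\<B>\<subseteq>circular_base X R. U = \<Union>\<B>"
  then obtain \<B> where "\<B> \<subseteq> circular_base X R" and U: "U = \<Union>\<B>" by auto
  then have "openin (circular_topology X R) B" if "B \<in> \<B>" for B
    unfolding circular_topology_def using that by (intro topology_generated_by_Basis) auto
  then show "openin (circular_topology X R) U"
    unfolding U by (rule openin_Union)
qed

definition compact_circularly_ordered_space :: "'k set \<Rightarrow> ('k \<times> 'k \<times> 'k) set \<Rightarrow> bool" where
  "compact_circularly_ordered_space K R \<longleftrightarrow>
     circular_order K R \<and> compact_space (circular_topology K R)"

text \<open>Maps on a set \<open>K\<close> are represented, as in \<open>BijGroup\<close>, by functions that are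
  \<open>undefined\<close> outside \<open>K\<close>.\<close>

definition H_plus :: "'k set \<Rightarrow> ('k \<times> 'k \<times> 'k) set \<Rightarrow> ('k \<Rightarrow> 'k) monoid" where
  "H_plus K R = BijGroup K \<lparr>carrier :=
     {g \<in> Bij K. homeomorphic_map (circular_topology K R) (circular_topology K R) g \<and>
        (\<forall>x\<in>K. \<forall>y\<in>K. \<forall>z\<in>K. (x, y, z) \<in> R \<longleftrightarrow> (g x, g y, g z) \<in> R)}\<rparr>"

definition compact_open_topology :: "'a topology \<Rightarrow> 'b topology \<Rightarrow> ('a \<Rightarrow> 'b) topology" where
  "compact_open_topology X Y = topology_generated_by
     {{f \<in> extensional (topspace X). continuous_map X Y f \<and> f ` C \<subseteq> U} | C U.
        compactin X C \<and> openin Y U}"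

definition H_plus_topology :: "'k set \<Rightarrow> ('k \<times> 'k \<times> 'k) set \<Rightarrow> ('k \<Rightarrow> 'k) topology" where
  "H_plus_topology K R =
     subtopology (compact_open_topology (circular_topology K R) (circular_topology K R))
       (carrier (H_plus K R))"

lemma topspace_H_plus_topology: "topspace (H_plus_topology K R) = carrier (H_plus K R)"
proof -
  have "carrier (H_plus K R) \<subseteq>
      {f \<in> extensional K. continuous_map (circular_topology K R) (circular_topology K R) f \<and> f ` {} \<subseteq> {}}"
    by (auto simp: H_plus_def Bij_def homeomorphic_imp_continuous_map)
  also have "\<dots> \<subseteq> topspace (compact_open_topology (circular_topology K R) (circular_topology K R))"
    unfolding compact_open_topology_def topology_generated_by_topspace topspace_circular_topology
    using compactin_empty openin_empty by blast
  finally show ?thesis by (auto simp: H_plus_topology_def)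
qed

definition topological_group :: "('a, 'b) monoid_scheme \<Rightarrow> 'a topology \<Rightarrow> bool" where
  "topological_group G T \<longleftrightarrow>
     group G \<and> topspace T = carrier G \<and>
     continuous_map (prod_topology T T) T (\<lambda>(x, y). x \<otimes>\<^bsub>G\<^esub> y) \<and>
     continuous_map T T (\<lambda>x. inv\<^bsub>G\<^esub> x)"

text \<open>HOL cannot quantify over types inside a formula, so the type \<open>'k\<close> from which the points of
  the compact space are drawn is a parameter.\<close>

definition c_orderly :: "'k itself \<Rightarrow> ('a, 'b) monoid_scheme \<Rightarrow> 'a topology \<Rightarrow> bool" where
  "c_orderly (_ :: 'k itself) G T \<longleftrightarrow>
     topological_group G T \<and>
     (\<exists>(K :: 'k set) R \<phi>. compact_circularly_ordered_space K R \<and>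
        \<phi> \<in> hom G (H_plus K R) \<and> inj_on \<phi> (carrier G) \<and>
        embedding_map T (H_plus_topology K R) \<phi>)"

end

theory Submission
  imports Defs
begin

text \<open>If \<open>G\<close> acts faithfully on a circularly ordered set \<open>K\<close>, well-order \<open>K\<close> with a chosen
  point \<open>x0\<close>. Cutting \<open>K\<close> at \<open>g x0\<close> orders linearly the elements of \<open>G\<close> that agree with \<open>g\<close>
  at \<open>x0\<close>, by comparing them at the first point where they differ; the lexicographic combination of
  the circular order on the orbit of \<open>x0\<close> with these linear orders is left invariant.

  Conversely, a left circularly ordered group acts on the space of its cuts, which is a closed
  subset of the space of all binary relations on \<open>G\<close> and hence compact. For \<open>a \<noteq> b\<close> the cuts
  placing \<open>a\<close> before \<open>b\<close> form an open set, and finitely many conditions of this kind determine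
  a translation, so the topology induced on \<open>G\<close> is discrete.\<close>

section \<open>Elementary facts about circular orders\<close>

lemma circular_orderI:
  assumes "R \<subseteq> X \<times> X \<times> X"
    and "\<And>a b c. (a, b, c) \<in> R \<Longrightarrow> (b, c, a) \<in> R"
    and "\<And>a b c. (a, b, c) \<in> R \<Longrightarrow> (b, a, c) \<notin> R"
    and "\<And>a b c d. (a, b, c) \<in> R \<Longrightarrow> (a, c, d) \<in> R \<Longrightarrow> (a, b, d) \<in> R"
    and "\<And>a b c. a \<in> X \<Longrightarrow> b \<in> X \<Longrightarrow> c \<in> X \<Longrightarrow> a \<noteq> b \<Longrightarrow> b \<noteq> c \<Longrightarrow> a \<noteq> c \<Longrightarrow>
      (a, b, c) \<in> R \<or> (a, c, b) \<in> R"
  shows "circular_order X R"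
proof -
  have "\<forall>a\<in>X. \<forall>b\<in>X. \<forall>c\<in>X. a \<noteq> b \<and> b \<noteq> c \<and> a \<noteq> c \<longrightarrow> (a, b, c) \<in> R \<or> (a, c, b) \<in> R"
    using assms(5) by simp
  moreover have "\<forall>a b c d. (a, b, c) \<in> R \<and> (a, c, d) \<in> R \<longrightarrow> (a, b, d) \<in> R"
    using assms(4) by blast
  moreover have "\<forall>a b c. (a, b, c) \<in> R \<longrightarrow> (b, c, a) \<in> R"
    using assms(2) by blast
  moreover have "\<forall>a b c. (a, b, c) \<in> R \<longrightarrow> (b, a, c) \<notin> R"
    using assms(3) by blast
  ultimately show ?thesis
    unfolding circular_order_def by (intro conjI assms(1))
qed

locale circularly_ordered =
  fixes X :: "'a set" and R :: "('a \<times> 'a \<times> 'a) set"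
  assumes circular_order: "circular_order X R"
begin

lemmas order_axioms = circular_order[unfolded circular_order_def]

lemma carrier: "a \<in> X" "b \<in> X" "c \<in> X" if "(a, b, c) \<in> R"
  using subsetD[OF order_axioms[THEN conjunct1] that] by simp_all

lemma cyclic: "(a, b, c) \<in> R \<Longrightarrow> (b, c, a) \<in> R"
  using order_axioms[THEN conjunct2, THEN conjunct1] by blast

lemma asym: "(a, b, c) \<in> R \<Longrightarrow> (b, a, c) \<notin> R"
  using order_axioms[THEN conjunct2, THEN conjunct2, THEN conjunct1] by blast

lemma trans: "(a, b, c) \<in> R \<Longrightarrow> (a, c, d) \<in> R \<Longrightarrow> (a, b, d) \<in> R"
  using order_axioms[THEN conjunct2, THEN conjunct2, THEN conjunct2, THEN conjunct1] by blast

lemma total: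
  "\<lbrakk>a \<in> X; b \<in> X; c \<in> X; a \<noteq> b; b \<noteq> c; a \<noteq> c\<rbrakk> \<Longrightarrow> (a, b, c) \<in> R \<or> (a, c, b) \<in> R"
  using order_axioms[THEN conjunct2, THEN conjunct2, THEN conjunct2, THEN conjunct2] by simp

lemma distinct: "a \<noteq> b" "b \<noteq> c" "a \<noteq> c" if "(a, b, c) \<in> R"
  using asym[of a b c] asym[of b c a] asym[of c a b] cyclic[of a b c] cyclic[of b c a] that by auto

text \<open>By totality, what the closed arc from \<open>a\<close> to \<open>b\<close> leaves out is
  the open arc from \<open>b\<close> to \<open>a\<close>, up to rotating the triple. Basic open sets
  thus become conditions on a single triple.\<close>

lemma not_between_iff:
  assumes "a \<in> X" "b \<in> X" "x \<in> X" "a \<noteq> b"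
  shows "x \<notin> closed_arc R a b \<longleftrightarrow> (a, b, x) \<in> R"
  using assms total[of a b x] distinct[of a b x] asym[of a x b] cyclic[of a b x] cyclic[of b x a]
    cyclic[of x a b] cyclic[of x b a] cyclic[of b a x]
  unfolding closed_arc_def open_arc_def by auto

lemma closed_arc_self: "closed_arc R a a = {a}"
  using distinct(3)[of a _ a] unfolding closed_arc_def open_arc_def by auto

end

subsection \<open>Faithful actions on circularly ordered sets\<close>

text \<open>The clauses sort triples by their fibres under \<open>f\<close>. Three different fibres
  are ordered by \<open>R\<close>. If exactly two points share a fibre, the order \<open>L\<close>
  of these two decides. Within one fibre the linear order \<open>L\<close> is closed up into a
  circle.\<close>

lemma circular_order_lexicographic:
  fixes f :: "'a \<Rightarrow> 'k" and L :: "'a \<Rightarrow> 'a \<Rightarrow> bool"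
  assumes K: "circular_order K R" and f: "f \<in> X \<rightarrow> K"
    and irrefl: "\<And>a. \<not> L a a"
    and trans: "\<And>a b c. L a b \<Longrightarrow> L b c \<Longrightarrow> L a c"
    and fibre: "\<And>a b. L a b \<Longrightarrow> f a = f b"
    and tot: "\<And>a b. a \<in> X \<Longrightarrow> b \<in> X \<Longrightarrow> f a = f b \<Longrightarrow> a \<noteq> b \<Longrightarrow> L a b \<or> L b a"
  shows "circular_order X {(a, b, c). a \<in> X \<and> b \<in> X \<and> c \<in> X \<and>
    ((f a, f b, f c) \<in> R \<or> L a b \<and> f c \<noteq> f a \<or> L b c \<and> f a \<noteq> f b \<or> L c a \<and> f b \<noteq> f c \<or>
     L a b \<and> L b c \<or> L b c \<and> L c a \<or> L c a \<and> L a b)}"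
proof -
  interpret K: circularly_ordered K R using K by unfold_locales
  define C where "C a b c \<longleftrightarrow> (f a, f b, f c) \<in> R \<or> L a b \<and> f c \<noteq> f a \<or> L b c \<and> f a \<noteq> f b \<or>
    L c a \<and> f b \<noteq> f c \<or> L a b \<and> L b c \<or> L b c \<and> L c a \<or> L c a \<and> L a b" for a b c
  note d = K.distinct
  have asymL: "\<not> L b a" if "L a b" for a b using that irrefl trans by blast
  have 1: "C b c a" if "C a b c" for a b c
    using that K.cyclic[of "f a" "f b" "f c"] unfolding C_def by argo
  have 2: "\<not> C b a c" if "C a b c" for a b c
  proof -
    note facts = fibre[of a b] fibre[of b c] fibre[of c a] fibre[of b a] fibre[of c b] fibre[of a c]
      asymL[of a b] asymL[of b c] asymL[of c a]
      K.asym[of "f a" "f b" "f c"] d[of "f a" "f b" "f c"] d[of "f b" "f a" "f c"]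
    show ?thesis using that facts unfolding C_def by smt
  qed
  have 3: "C a b e" if "C a b c" "C a c e" for a b c e
  proof -
    note facts = fibre[of a b] fibre[of b c] fibre[of c a] fibre[of a c] fibre[of c e] fibre[of e a]
      trans[of b c e] trans[of e a b] asymL[of a c]
      K.trans[of "f a" "f b" "f c" "f e"] d[of "f a" "f b" "f c"] d[of "f a" "f c" "f e"]
    show ?thesis using that facts unfolding C_def by smt
  qed
  have 4: "C a b c \<or> C a c b" if "a \<in> X" "b \<in> X" "c \<in> X" "a \<noteq> b" "b \<noteq> c" "a \<noteq> c" for a b c
  proof -
    have "f a \<in> K" "f b \<in> K" "f c \<in> K" using that f by auto
    note facts = this tot[of a b] tot[of b c] tot[of a c] K.total[of "f a" "f b" "f c"]
    show ?thesis using that facts unfolding C_def by smt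
  qed
  have "circular_order X {(a, b, c). a \<in> X \<and> b \<in> X \<and> c \<in> X \<and> C a b c}"
  proof (rule circular_orderI, unfold mem_Collect_eq prod.case, goal_cases)
    case 1 then show ?case by auto
  next
    case (2 a b c) then show ?case using 1[of a b c] by simp
  next
    case (3 a b c) then show ?case using 2[of a b c] by simp
  next
    case (4 a b c d) then show ?case using 3[of a b c d] by simp
  next
    case (5 a b c) then show ?case using 4[of a b c] by simp
  qed
  then show ?thesis unfolding C_def .
qed

text \<open>Invariance holds because each \<open>act k\<close> is injective and preserves
  \<open>R\<close>: translation by \<open>k\<close> moves neither the place of the first difference
  nor the outcome of the comparison there.\<close>

lemma left_circularly_orderable_if_faithful_action:
  fixes G :: "('a, 'b) monoid_scheme" and act :: "'a \<Rightarrow> 'k \<Rightarrow> 'k"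
  assumes G: "group G" and K: "circular_order K R"
    and inj: "\<And>g. g \<in> carrier G \<Longrightarrow> inj_on (act g) K"
    and closed: "\<And>g x. g \<in> carrier G \<Longrightarrow> x \<in> K \<Longrightarrow> act g x \<in> K"
    and mult: "\<And>g h x. g \<in> carrier G \<Longrightarrow> h \<in> carrier G \<Longrightarrow> x \<in> K \<Longrightarrow>
      act (g \<otimes>\<^bsub>G\<^esub> h) x = act g (act h x)"
    and pres: "\<And>g x y z. g \<in> carrier G \<Longrightarrow> x \<in> K \<Longrightarrow> y \<in> K \<Longrightarrow> z \<in> K \<Longrightarrow>
      (x, y, z) \<in> R \<longleftrightarrow> (act g x, act g y, act g z) \<in> R"
    and faithful: "\<And>g h. g \<in> carrier G \<Longrightarrow> h \<in> carrier G \<Longrightarrow>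
      \<forall>x\<in>K. act g x = act h x \<Longrightarrow> g = h"
  shows "left_circularly_orderable G"
proof (cases "K = {}")
  case True
  \<comment> \<open>On an empty space faithfulness identifies all elements of \<open>G\<close>, so
    no three are distinct and the empty relation is a circular order.\<close>
  then have "g = h" if "g \<in> carrier G" "h \<in> carrier G" for g h
    using faithful that by blast
  then have "circular_order (carrier G) {}" unfolding circular_order_def by blast
  then show ?thesis unfolding left_circularly_orderable_def by (intro exI[of _ "{}"]) auto
next
  case False
  then obtain x0 where x0: "x0 \<in> K" by auto
  interpret G: group G by (rule G)
  interpret K: circularly_ordered K R using K by unfold_locales
  obtain W where W: "well_order_on K W" using well_order_on by blast
  have W_total: "x = y \<or> (x, y) \<in> W \<or> (y, x) \<in> W" if "x \<in> K" "y \<in> K" for x y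
    using W that unfolding well_order_on_def linear_order_on_def total_on_def by blast
  have W_trans: "(x, z) \<in> W" if "(x, y) \<in> W" "(y, z) \<in> W" for x y z
    using W that unfolding well_order_on_def linear_order_on_def partial_order_on_def
      preorder_on_def trans_def by blast
  have W_antisym: "x = y" if "(x, y) \<in> W" "(y, x) \<in> W" for x y
    using W that unfolding well_order_on_def linear_order_on_def partial_order_on_def
      antisym_def by blast
  have W_wf: "wf (W - Id)" using W unfolding well_order_on_def by simp
  \<comment> \<open>The point \<open>x\<close> is the \<open>W\<close>-least one at which
    \<open>g\<close> and \<open>h\<close> differ, and cutting the circle at \<open>act g x0\<close>
    puts \<open>act g x\<close> before \<open>act h x\<close>. The relation \<open>L\<close> applies
    this only when \<open>g\<close> and \<open>h\<close> agree at \<open>x0\<close>, so that both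
    sides of a comparison use the same cutting point.\<close>
  define D where "D g h x \<longleftrightarrow> x \<in> K \<and> (act g x0, act g x, act h x) \<in> R \<and>
    (\<forall>y\<in>K. (y, x) \<in> W \<and> y \<noteq> x \<longrightarrow> act g y = act h y)" for g h x
  define L where "L g h \<longleftrightarrow> g \<in> carrier G \<and> h \<in> carrier G \<and> act g x0 = act h x0 \<and> (\<exists>x. D g h x)"
    for g h
  have act_eq: "act g x = act g y \<longleftrightarrow> x = y" if "g \<in> carrier G" "x \<in> K" "y \<in> K" for g x y
    using inj[OF that(1)] that(2,3) by (auto dest: inj_onD)
  have irrefl: "\<not> L g g" for g
    unfolding L_def D_def using K.distinct by blast
  have trans: "L g k" if gh: "L g h" and hk: "L h k" for g h k
  proof -
    obtain x y where x: "D g h x" and y: "D h k y" using gh hk unfolding L_def by auto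
    have e: "act g x0 = act h x0" using gh unfolding L_def by simp
    have xy: "x \<in> K" "y \<in> K" using x y unfolding D_def by auto
    \<comment> \<open>The \<open>W\<close>-earlier of the two first differences is the first
      difference of \<open>g\<close> and \<open>k\<close>. When the two coincide, transitivity of
      \<open>R\<close> at the common cutting point decides.\<close>
    consider "x = y" | "(x, y) \<in> W" "x \<noteq> y" | "(y, x) \<in> W" "x \<noteq> y"
      using W_total[OF xy] by auto
    then have "\<exists>x. D g k x"
    proof cases
      case 1
      then have "D g k x" using x y e K.trans[of "act g x0" "act g x" "act h x" "act k x"]
        unfolding D_def by simp
      then show ?thesis ..
    next
      case 2
      have "act h z = act k z" if "z \<in> K" "(z, x) \<in> W" for z
        using that 2 y W_trans[of z x y] W_antisym[of x y] unfolding D_def by metis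
      moreover have "(x, x) \<in> W"
        using W xy unfolding well_order_on_def linear_order_on_def partial_order_on_def
          preorder_on_def refl_on_def by auto
      ultimately have "D g k x" using x xy unfolding D_def by simp
      then show ?thesis ..
    next
      case 3
      have "act g z = act h z" if "z \<in> K" "(z, y) \<in> W" for z
        using that 3 x W_trans[of z y x] W_antisym[of x y] unfolding D_def by metis
      moreover have "(y, y) \<in> W"
        using W xy unfolding well_order_on_def linear_order_on_def partial_order_on_def
          preorder_on_def refl_on_def by auto
      ultimately have "D g k y" using y xy e unfolding D_def by simp
      then show ?thesis ..
    qed
    then show ?thesis using gh hk unfolding L_def by simp
  qed
  have total: "L g h \<or> L h g"
    if gh: "g \<in> carrier G" "h \<in> carrier G" "act g x0 = act h x0" "g \<noteq> h" for g h
  proof -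
    let ?S = "{x \<in> K. act g x \<noteq> act h x}"
    have "\<exists>x\<in>K. act g x \<noteq> act h x" using faithful[OF gh(1,2)] gh(4) by blast
    then obtain x' where "x' \<in> ?S" by blast
    then obtain x where "x \<in> ?S" and "\<And>y. (y, x) \<in> W - Id \<Longrightarrow> y \<notin> ?S"
      using wfE_min[OF W_wf, of x' ?S] by blast
    then have x: "x \<in> K" "act g x \<noteq> act h x"
      and min: "\<And>y. (y, x) \<in> W - Id \<Longrightarrow> y \<in> K \<Longrightarrow> act g y = act h y"
      by blast+
    \<comment> \<open>Totality of \<open>R\<close> applies only to three distinct points. Since
      \<open>g\<close> and \<open>h\<close> agree at \<open>x0\<close> but not at \<open>x\<close>,
      injectivity of the action separates the cutting point from both images of
      \<open>x\<close>.\<close>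
    have "x0 \<noteq> x" using x gh(3) by blast
    then have "act g x0 \<noteq> act g x" "act g x0 \<noteq> act h x"
      using act_eq[OF gh(1) x0 x(1)] act_eq[OF gh(2) x0 x(1)] gh(3) by simp_all
    then have "(act g x0, act g x, act h x) \<in> R \<or> (act g x0, act h x, act g x) \<in> R"
      using K.total[of "act g x0" "act g x" "act h x"] closed[OF gh(1) x0] closed[OF gh(1) x(1)]
        closed[OF gh(2) x(1)] x(2) by blast
    moreover have "\<forall>y\<in>K. (y, x) \<in> W \<and> y \<noteq> x \<longrightarrow> act g y = act h y" using min by blast
    ultimately have "D g h x \<or> D h g x" using x gh(3) unfolding D_def by metis
    then show ?thesis unfolding L_def using gh by metis
  qed
  have D_act: "D (k \<otimes>\<^bsub>G\<^esub> g) (k \<otimes>\<^bsub>G\<^esub> h) x \<longleftrightarrow> D g h x"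
    if "k \<in> carrier G" "g \<in> carrier G" "h \<in> carrier G" for k g h x
  proof (cases "x \<in> K")
    case True
    then have "(act k (act g x0), act k (act g x), act k (act h x)) \<in> R \<longleftrightarrow>
        (act g x0, act g x, act h x) \<in> R"
      using pres[of k "act g x0" "act g x" "act h x"] closed x0 that by blast
    then show ?thesis unfolding D_def using that True x0 by (simp add: mult closed act_eq)
  qed (simp add: D_def)
  have L_act: "L (k \<otimes>\<^bsub>G\<^esub> g) (k \<otimes>\<^bsub>G\<^esub> h) \<longleftrightarrow> L g h"
    if "k \<in> carrier G" "g \<in> carrier G" "h \<in> carrier G" for k g h
  proof -
    have "D (k \<otimes>\<^bsub>G\<^esub> g) (k \<otimes>\<^bsub>G\<^esub> h) = D g h" using D_act[OF that] by (rule ext)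
    then show ?thesis using that x0 unfolding L_def by (simp add: mult closed act_eq)
  qed
  have fibre: "act g x0 = act h x0" if "L g h" for g h using that unfolding L_def by simp
  define C where "C = {(a, b, c). a \<in> carrier G \<and> b \<in> carrier G \<and> c \<in> carrier G \<and>
    ((act a x0, act b x0, act c x0) \<in> R \<or> L a b \<and> act c x0 \<noteq> act a x0 \<or>
     L b c \<and> act a x0 \<noteq> act b x0 \<or> L c a \<and> act b x0 \<noteq> act c x0 \<or>
     L a b \<and> L b c \<or> L b c \<and> L c a \<or> L c a \<and> L a b)}"
  have maps: "(\<lambda>g. act g x0) \<in> carrier G \<rightarrow> K" using closed x0 by auto
  have "circular_order (carrier G) C"
    unfolding C_def by (rule circular_order_lexicographic[OF K maps irrefl trans fibre total])
  moreover have "\<forall>g\<in>carrier G. \<forall>x\<in>carrier G. \<forall>y\<in>carrier G. \<forall>z\<in>carrier G.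
    (x, y, z) \<in> C \<longleftrightarrow> (g \<otimes>\<^bsub>G\<^esub> x, g \<otimes>\<^bsub>G\<^esub> y, g \<otimes>\<^bsub>G\<^esub> z) \<in> C"
  proof (intro ballI)
    fix g x y z
    assume g: "g \<in> carrier G" "x \<in> carrier G" "y \<in> carrier G" "z \<in> carrier G"
    then have "(act g (act x x0), act g (act y x0), act g (act z x0)) \<in> R \<longleftrightarrow>
        (act x x0, act y x0, act z x0) \<in> R"
      using pres[of g "act x x0" "act y x0" "act z x0"] closed x0 by blast
    then show "(x, y, z) \<in> C \<longleftrightarrow> (g \<otimes>\<^bsub>G\<^esub> x, g \<otimes>\<^bsub>G\<^esub> y, g \<otimes>\<^bsub>G\<^esub> z) \<in> C"
      unfolding C_def using g by (simp add: mult closed x0 act_eq L_act)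
  qed
  ultimately show ?thesis unfolding left_circularly_orderable_def by (intro exI[of _ C] conjI)
qed

text \<open>An injective homomorphism into \<open>H_plus K R\<close> is a faithful action on
  \<open>K\<close>: elements of \<open>Bij K\<close> are extensional, so maps that agree on
  \<open>K\<close> are equal and injectivity of \<phi> applies.\<close>

lemma left_circularly_orderable_if_c_orderly:
  fixes G :: "('a, 'b) monoid_scheme"
  assumes "group G" "c_orderly TYPE('k) G T"
  shows "left_circularly_orderable G"
proof -
  obtain K :: "'k set" and R \<phi> where K: "circular_order K R"
    and \<phi>: "\<phi> \<in> hom G (H_plus K R)" and inj: "inj_on \<phi> (carrier G)"
    using assms(2) unfolding c_orderly_def compact_circularly_ordered_space_def by auto
  have H: "\<phi> g \<in> carrier (H_plus K R)" if "g \<in> carrier G" for g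
    using \<phi> that by (auto simp: hom_def)
  have Bij: "\<phi> g \<in> Bij K" if "g \<in> carrier G" for g
    using H[OF that] unfolding H_plus_def by simp
  have mult: "\<phi> (g \<otimes>\<^bsub>G\<^esub> h) = compose K (\<phi> g) (\<phi> h)" if "g \<in> carrier G" "h \<in> carrier G" for g h
    using hom_mult[OF \<phi> that] Bij that by (simp add: H_plus_def BijGroup_def)
  show ?thesis
  proof (rule left_circularly_orderable_if_faithful_action[OF assms(1) K])
    fix g assume g: "g \<in> carrier G"
    show "inj_on (\<phi> g) K" using Bij[OF g] by (auto simp: Bij_def bij_betw_def)
    show "\<phi> g x \<in> K" if "x \<in> K" for x using Bij[OF g] that by (auto simp: Bij_def bij_betw_def)
    show "\<phi> (g \<otimes>\<^bsub>G\<^esub> h) x = \<phi> g (\<phi> h x)" if "h \<in> carrier G" "x \<in> K" for h x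
      using mult[OF g that(1)] that(2) by (simp add: compose_def)
    show "(x, y, z) \<in> R \<longleftrightarrow> (\<phi> g x, \<phi> g y, \<phi> g z) \<in> R" if "x \<in> K" "y \<in> K" "z \<in> K" for x y z
      using H[OF g] that unfolding H_plus_def by simp
    show "g = h" if h: "h \<in> carrier G" and e: "\<forall>x\<in>K. \<phi> g x = \<phi> h x" for h
    proof -
      have "\<phi> g = \<phi> h"
        using Bij[OF g] Bij[OF h] e by (intro extensionalityI[of _ K]) (auto simp: Bij_def)
      then show ?thesis using inj g h by (auto dest: inj_onD)
    qed
  qed
qed

subsection \<open>Cuts\<close>

text \<open>A cut is a strict linear order that induces the given circular order: reading the circle
  from the cut onwards. Every point \<open>e\<close> carries two cuts, one with \<open>e\<close> as first element
  and one with \<open>e\<close> as last element.\<close>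

definition cuts :: "'a set \<Rightarrow> ('a \<times> 'a \<times> 'a) set \<Rightarrow> ('a \<times> 'a) set set" where
  "cuts X R = {L. L \<subseteq> X \<times> X \<and> (\<forall>x. (x, x) \<notin> L) \<and>
     (\<forall>x y z. (x, y) \<in> L \<and> (y, z) \<in> L \<longrightarrow> (x, z) \<in> L \<and> (x, y, z) \<in> R) \<and>
     (\<forall>x\<in>X. \<forall>y\<in>X. x \<noteq> y \<longrightarrow> (x, y) \<in> L \<or> (y, x) \<in> L)}"

text \<open>The cuts read the three points as xyz, yzx and zxy. So \<open>L\<close> sits on the arc
  from \<open>z\<close> to \<open>x\<close>, \<open>M\<close> on the arc from \<open>x\<close> to
  \<open>y\<close>, and \<open>N\<close> on the arc from \<open>y\<close> to
  \<open>z\<close>.\<close>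

definition rotates :: "('a \<times> 'a) set \<Rightarrow> ('a \<times> 'a) set \<Rightarrow> ('a \<times> 'a) set \<Rightarrow> 'a \<Rightarrow> 'a \<Rightarrow> 'a \<Rightarrow> bool"
  where "rotates L M N x y z \<longleftrightarrow> (x, y) \<in> L \<and> (y, z) \<in> L \<and> (y, z) \<in> M \<and> (z, x) \<in> M \<and>
     (z, x) \<in> N \<and> (x, y) \<in> N"

text \<open>Stated through witnesses, the order mentions no base point. Its invariance under
  translation and its openness in each cut can then be read off; the order axioms come from
  \<open>cut_order_iff\<close>.\<close>

definition cut_order :: "'a set \<Rightarrow> ('a \<times> 'a \<times> 'a) set \<Rightarrow>
    (('a \<times> 'a) set \<times> ('a \<times> 'a) set \<times> ('a \<times> 'a) set) set" where
  "cut_order X R = {(L, M, N). L \<in> cuts X R \<and> M \<in> cuts X R \<and> N \<in> cuts X R \<and>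
     (\<exists>x y z. rotates L M N x y z)}"

text \<open>This set records the position of a cut seen from a base point \<open>e\<close>: it
  consists of what is met between the cut and \<open>e\<close>, so it shrinks as the cut advances
  from just after \<open>e\<close> round to just before \<open>e\<close>.\<close>

definition before :: "('a \<times> 'a) set \<Rightarrow> 'a \<Rightarrow> 'a set" where
  "before L e = {x. (x, e) \<in> L}"

text \<open>The circle obtained by closing up a chain of sets under reverse inclusion: the three
  disjuncts are the rotations of a strictly decreasing triple.\<close>

definition cyclically_decreasing :: "'a set \<Rightarrow> 'a set \<Rightarrow> 'a set \<Rightarrow> bool" where
  "cyclically_decreasing A B C \<longleftrightarrow> C \<subset> B \<and> B \<subset> A \<or> A \<subset> C \<and> C \<subset> B \<or> B \<subset> A \<and> A \<subset> C"

lemma cyclically_decreasing_total: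
  assumes "A \<subset> B \<or> B \<subset> A" "B \<subset> C \<or> C \<subset> B" "A \<subset> C \<or> C \<subset> A"
  shows "cyclically_decreasing A B C \<or> cyclically_decreasing A C B"
  using assms unfolding cyclically_decreasing_def by (elim disjE) simp_all

lemma cutsI:
  assumes "L \<subseteq> X \<times> X" "\<And>x. (x, x) \<notin> L"
    and "\<And>x y z. (x, y) \<in> L \<Longrightarrow> (y, z) \<in> L \<Longrightarrow> (x, z) \<in> L"
    and "\<And>x y z. (x, y) \<in> L \<Longrightarrow> (y, z) \<in> L \<Longrightarrow> (x, y, z) \<in> R"
    and "\<And>x y. x \<in> X \<Longrightarrow> y \<in> X \<Longrightarrow> x \<noteq> y \<Longrightarrow> (x, y) \<in> L \<or> (y, x) \<in> L"
  shows "L \<in> cuts X R"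
  unfolding cuts_def using assms by blast

context
  fixes L X R
  assumes L: "L \<in> cuts X R"
begin

lemma cut_carrier: "x \<in> X" "y \<in> X" if "(x, y) \<in> L"
proof -
  have "L \<subseteq> X \<times> X" using L[unfolded cuts_def mem_Collect_eq, THEN conjunct1] .
  then show "x \<in> X" "y \<in> X" using that by blast+
qed

lemma cut_irrefl: "(x, x) \<notin> L"
  using L unfolding cuts_def by blast

lemma cut_trans: "(x, y) \<in> L \<Longrightarrow> (y, z) \<in> L \<Longrightarrow> (x, z) \<in> L"
  using L unfolding cuts_def by blast

lemma cut_compatible: "(x, y) \<in> L \<Longrightarrow> (y, z) \<in> L \<Longrightarrow> (x, y, z) \<in> R"
  using L unfolding cuts_def by blast

lemma cut_total: "x \<in> X \<Longrightarrow> y \<in> X \<Longrightarrow> x \<noteq> y \<Longrightarrow> (x, y) \<in> L \<or> (y, x) \<in> L"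
  using L unfolding cuts_def by blast

lemma cut_asym: "(x, y) \<in> L \<Longrightarrow> (y, x) \<notin> L"
  using cut_trans cut_irrefl by blast

end

section \<open>Initial segments of cuts and the circular order axioms\<close>

context circularly_ordered
begin

text \<open>If \<open>e\<close> lay on none of the three arcs, reading the circle from
  \<open>e\<close> would put \<open>x\<close> before \<open>y\<close>, \<open>y\<close> before
  \<open>z\<close> and \<open>z\<close> before \<open>x\<close>.\<close>

lemma arc_cases:
  assumes "(x, y, z) \<in> R" "e \<in> X"
  obtains "e = x \<or> (x, e, y) \<in> R" | "e = y \<or> (y, e, z) \<in> R" | "e = z \<or> (z, e, x) \<in> R"
proof -
  have "(x, e, y) \<in> R \<or> (y, e, z) \<in> R \<or> (z, e, x) \<in> R" if ne: "e \<noteq> x" "e \<noteq> y" "e \<noteq> z"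
  proof (rule ccontr)
    assume *: "\<not> ?thesis"
    note X = carrier[OF assms(1)] and d = distinct[OF assms(1)]
    have xy: "(x, y, e) \<in> R" using total[of x e y] X d ne assms(2) * by metis
    have yz: "(y, z, e) \<in> R" using total[of y e z] X d ne assms(2) * by metis
    have zx: "(z, x, e) \<in> R" using total[of z e x] X d ne assms(2) * by metis
    have "(e, x, z) \<in> R"
      by (rule trans[OF cyclic[OF cyclic[OF xy]] cyclic[OF cyclic[OF yz]]])
    then show False using asym[OF zx] cyclic[of e x z] by blast
  qed
  then show thesis using that by blast
qed

text \<open>No two of the pairs \<open>(x, y)\<close>, \<open>(y, z)\<close>, \<open>(z, x)\<close>
  can be reversed in \<open>L\<close>, since compatibility would produce the opposite triple. Hence
  at least two of them lie in \<open>L\<close>, and the choices are the three rotations of the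
  triple.\<close>

lemma cut_cases:
  assumes L: "L \<in> cuts X R" and "(x, y, z) \<in> R"
  obtains "(x, y) \<in> L" "(y, z) \<in> L" | "(y, z) \<in> L" "(z, x) \<in> L" | "(z, x) \<in> L" "(x, y) \<in> L"
proof -
  note d = distinct[OF assms(2)] and X = carrier[OF assms(2)]
  have False if "(y, x) \<in> L" "(z, y) \<in> L"
    using cut_compatible[OF L that(2,1)] asym cyclic assms(2) by blast
  moreover have False if "(y, x) \<in> L" "(x, z) \<in> L"
    using cut_compatible[OF L that] asym cyclic assms(2) by blast
  moreover have False if "(z, y) \<in> L" "(x, z) \<in> L"
    using cut_compatible[OF L that(2,1)] asym cyclic assms(2) by blast
  ultimately show thesis
    using that cut_total[OF L X(1,2) d(1)] cut_total[OF L X(2,3) d(2)] cut_total[OF L X(1,3) d(3)]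
    by blast
qed

text \<open>Seen from \<open>e\<close>, the set \<open>before L e\<close> is a final segment of the
  circle cut at \<open>e\<close>. Final segments of one linear order are nested, which gives
  \<open>before_chain\<close>.\<close>

lemma before_upward_closed:
  assumes L: "L \<in> cuts X R" and "x \<in> before L e" "(e, x, y) \<in> R"
  shows "y \<in> before L e"
  using assms(2) unfolding before_def mem_Collect_eq
  by (cases rule: cut_cases[OF L assms(3)]) (use cut_asym[OF L] in blast)+

lemma before_subset: "L \<in> cuts X R \<Longrightarrow> before L e \<subseteq> X - {e}"
  unfolding before_def using cut_carrier(1) cut_irrefl by fast

lemma before_chain:
  assumes L: "L \<in> cuts X R" and M: "M \<in> cuts X R" and e: "e \<in> X"
  shows "before L e \<subseteq> before M e \<or> before M e \<subseteq> before L e"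
proof (rule ccontr)
  assume "\<not> ?thesis"
  then obtain u v where uv: "u \<in> before L e" "u \<notin> before M e" "v \<in> before M e" "v \<notin> before L e"
    by blast
  then have "u \<in> X" "v \<in> X" "u \<noteq> e" "v \<noteq> e" "u \<noteq> v"
    using before_subset[OF L] before_subset[OF M] by blast+
  then consider "(e, u, v) \<in> R" | "(e, v, u) \<in> R" using total[OF e, of u v] by metis
  then show False
    using before_upward_closed[OF L uv(1)] before_upward_closed[OF M uv(3)] uv by cases blast+
qed

lemma after:
  assumes L: "L \<in> cuts X R" and "x \<in> X" "e \<in> X" "x \<noteq> e" "x \<notin> before L e"
  shows "(e, x) \<in> L"
  using cut_total[OF L assms(2-4)] assms(5) unfolding before_def by blast

text \<open>The position of \<open>e\<close> determines the whole cut: elements on different sides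
  of \<open>e\<close> are ordered by their sides, and elements on the same side are ordered by
  \<open>R\<close> read from \<open>e\<close>.\<close>

lemma before_inj:
  assumes L: "L \<in> cuts X R" and M: "M \<in> cuts X R" and e: "e \<in> X"
    and eq: "before L e = before M e"
  shows "L = M"
proof -
  have sub: "L \<subseteq> M"
    if L: "L \<in> cuts X R" and M: "M \<in> cuts X R" and eq: "before L e = before M e" for L M
  proof (rule subrelI)
    fix x y assume xy: "(x, y) \<in> L"
    have X: "x \<in> X" "y \<in> X" "x \<noteq> y" using cut_carrier[OF L xy] cut_irrefl[OF L] xy by auto
    have e_iff: "(u, e) \<in> L \<longleftrightarrow> (u, e) \<in> M" for u using eq unfolding before_def by blast
    have e_iff': "(e, u) \<in> L \<longleftrightarrow> (e, u) \<in> M" for u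
      using e_iff[of u] cut_total[OF L e, of u] cut_total[OF M e, of u] cut_asym[OF L]
        cut_asym[OF M] cut_carrier[OF L] cut_carrier[OF M] cut_irrefl[OF L] cut_irrefl[OF M] by metis
    show "(x, y) \<in> M"
    proof (rule ccontr)
      assume "(x, y) \<notin> M"
      then have yx: "(y, x) \<in> M" using cut_total[OF M X] by blast
      have ne: "x \<noteq> e" "y \<noteq> e"
        using e_iff[of x] e_iff'[of y] xy yx cut_asym[OF M] by blast+
      consider "(e, x) \<in> L" | "(x, e) \<in> L" "(e, y) \<in> L" | "(y, e) \<in> L"
        using cut_total[OF L X(1) e ne(1)] cut_total[OF L X(2) e ne(2)] by blast
      then show False
      proof cases
        case 1
        then have "(e, x, y) \<in> R" using cut_compatible[OF L] xy by blast
        moreover have "(e, y) \<in> M" using cut_trans[OF L 1 xy] e_iff' by blast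
        then have "(e, y, x) \<in> R" using cut_compatible[OF M] yx by blast
        ultimately show False using asym cyclic by blast
      next
        case 2
        then show False using e_iff e_iff' cut_trans[OF M] yx cut_asym[OF M] by blast
      next
        case 3
        then have "(x, y, e) \<in> R" using cut_compatible[OF L xy] by blast
        moreover have "(x, e) \<in> M" using cut_trans[OF L xy 3] e_iff by blast
        then have "(y, x, e) \<in> R" using cut_compatible[OF M] yx by blast
        ultimately show False using asym by blast
      qed
    qed
  qed
  show ?thesis using sub[OF L M eq] sub[OF M L eq[symmetric]] by (rule equalityI)
qed

text \<open>The cuts \<open>M\<close> and \<open>N\<close> lie off the arc from \<open>z\<close> to
  \<open>x\<close>, so they place \<open>e\<close> in a known way among the three points. Only
  \<open>L\<close> cuts that arc, and it does so after \<open>e\<close> or before it. The assumption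
  on \<open>e\<close> is one of the three cases of \<open>arc_cases\<close>; the others follow by
  rotation.\<close>

lemma rotates_imp_cyclically_decreasing:
  assumes L: "L \<in> cuts X R" and M: "M \<in> cuts X R" and N: "N \<in> cuts X R" and e: "e \<in> X"
    and rot: "rotates L M N x y z" and arc: "e = z \<or> (z, e, x) \<in> R"
  shows "cyclically_decreasing (before L e) (before M e) (before N e)"
proof -
  have r: "(x, y) \<in> L" "(y, z) \<in> L" "(y, z) \<in> M" "(z, x) \<in> M" "(z, x) \<in> N" "(x, y) \<in> N"
    using rot unfolding rotates_def by auto
  note chain = before_chain[OF L M e] before_chain[OF M N e] before_chain[OF L N e]
  \<comment> \<open>If \<open>L\<close> cuts after \<open>e\<close>, the segments decrease in the
    order L, M, N; if it cuts before \<open>e\<close>, they decrease in the order M, N, L. They are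
    nested by \<open>chain\<close>, and the listed memberships make the inclusions strict.\<close>
  have "x \<in> before L e \<and> y \<in> before L e \<and> y \<in> before M e \<and> x \<notin> before M e \<and>
      x \<notin> before N e \<and> y \<notin> before N e \<or>
      x \<notin> before L e \<and> y \<notin> before L e \<and> z \<notin> before L e \<and> y \<in> before M e \<and> x \<notin> before M e \<and>
      z \<in> before M e \<and> x \<notin> before N e \<and> y \<notin> before N e \<and> z \<in> before N e"
    using arc
  proof
    assume "e = z"
    then show ?thesis unfolding before_def
      using r cut_trans[OF L] cut_asym[OF M] cut_trans[OF N] cut_asym[OF N] by blast
  next
    assume zex: "(z, e, x) \<in> R"
    have xz: "(x, z) \<in> L" using cut_trans[OF L] r by blast
    have M': "(z, e) \<in> M" "(e, x) \<in> M"
      using cut_cases[OF M zex] r cut_asym[OF M] by metis+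
    have N': "(z, e) \<in> N" "(e, x) \<in> N"
      using cut_cases[OF N zex] r cut_asym[OF N] by metis+
    have MN: "y \<in> before M e" "z \<in> before M e" "x \<notin> before M e"
        "z \<in> before N e" "x \<notin> before N e" "y \<notin> before N e"
      unfolding before_def mem_Collect_eq using M' N' r cut_trans[OF M] cut_asym[OF M]
        cut_trans[OF N] cut_asym[OF N] by blast+
    consider "(e, x) \<in> L" | "(z, e) \<in> L"
      using cut_cases[OF L zex] by metis
    then show ?thesis
    proof cases
      case 1
      then have "(e, y) \<in> L" "(e, z) \<in> L" using r xz cut_trans[OF L] by blast+
      then show ?thesis using 1 MN cut_asym[OF L] unfolding before_def by blast
    next
      case 2
      then have "(x, e) \<in> L" "(y, e) \<in> L" using r xz cut_trans[OF L] by blast+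
      then show ?thesis using MN unfolding before_def by blast
    qed
  qed
  then show ?thesis using chain unfolding cyclically_decreasing_def by blast
qed

text \<open>A point \<open>u\<close> lost between \<open>L\<close> and \<open>M\<close>, a point
  \<open>v\<close> lost between \<open>M\<close> and \<open>N\<close>, and \<open>e\<close> itself
  separate the three cuts.\<close>

lemma decreasing_imp_rotates:
  assumes L: "L \<in> cuts X R" and M: "M \<in> cuts X R" and N: "N \<in> cuts X R" and e: "e \<in> X"
    and dec: "before N e \<subset> before M e" "before M e \<subset> before L e"
  shows "\<exists>x y. rotates L M N x y e"
proof -
  obtain u v where u: "u \<in> before L e" "u \<notin> before M e" and v: "v \<in> before M e" "v \<notin> before N e"
    using dec by blast
  have uX: "u \<in> X" "u \<noteq> e" and vX: "v \<in> X" "v \<noteq> e" and vL: "v \<in> before L e"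
    and uN: "u \<notin> before N e"
    using before_subset[OF L] before_subset[OF M] u v dec by blast+
  have eu: "(e, u) \<in> M" "(e, u) \<in> N" "(e, v) \<in> N"
    using after[OF M uX(1) e uX(2) u(2)] after[OF N uX(1) e uX(2) uN]
      after[OF N vX(1) e vX(2) v(2)] by blast+
  have "(v, e, u) \<in> R" using cut_compatible[OF M _ eu(1), of v] v(1) unfolding before_def by blast
  then have euv: "(e, u, v) \<in> R" by (rule cyclic)
  have "(u, v) \<in> N"
    using cut_cases[OF N euv] eu cut_asym[OF N] by metis
  moreover have "(u, v) \<in> L"
    using cut_cases[OF L euv] u(1) vL cut_asym[OF L] unfolding before_def by (metis mem_Collect_eq)
  ultimately have "rotates L M N u v e"
    using eu u v vL unfolding rotates_def before_def by blast
  then show ?thesis by blast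
qed

lemma rotates_cycle: "rotates L M N x y z \<longleftrightarrow> rotates M N L y z x"
  unfolding rotates_def by blast

lemma cyclically_decreasing_cycle:
  "cyclically_decreasing A B C \<longleftrightarrow> cyclically_decreasing B C A"
  unfolding cyclically_decreasing_def by blast

text \<open>This holds at every base point, so \<open>e\<close> may be chosen to suit the use. It
  turns the circular order axioms for cuts into facts about nested sets.\<close>

lemma cut_order_iff:
  assumes e: "e \<in> X"
  shows "(L, M, N) \<in> cut_order X R \<longleftrightarrow> L \<in> cuts X R \<and> M \<in> cuts X R \<and> N \<in> cuts X R \<and>
    cyclically_decreasing (before L e) (before M e) (before N e)"
proof (cases "L \<in> cuts X R \<and> M \<in> cuts X R \<and> N \<in> cuts X R")
  case True
  then have L: "L \<in> cuts X R" and M: "M \<in> cuts X R" and N: "N \<in> cuts X R" by auto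
  have "cyclically_decreasing (before L e) (before M e) (before N e)"
    if rot: "rotates L M N x y z" for x y z
  proof -
    have "(x, y, z) \<in> R" using rot cut_compatible[OF L] unfolding rotates_def by blast
    then consider "e = x \<or> (x, e, y) \<in> R" | "e = y \<or> (y, e, z) \<in> R" | "e = z \<or> (z, e, x) \<in> R"
      using arc_cases[OF _ e] by blast
    then show ?thesis
    proof cases
      case 1
      have "rotates M N L y z x" using rot rotates_cycle by metis
      from rotates_imp_cyclically_decreasing[OF M N L e this 1] show ?thesis
        using cyclically_decreasing_cycle by metis
    next
      case 2
      have "rotates N L M z x y" using rot rotates_cycle by metis
      from rotates_imp_cyclically_decreasing[OF N L M e this 2] show ?thesis
        using cyclically_decreasing_cycle by metis
    next
      case 3
      from rotates_imp_cyclically_decreasing[OF L M N e rot 3] show ?thesis .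
    qed
  qed
  moreover have "\<exists>x y z. rotates L M N x y z"
    if "cyclically_decreasing (before L e) (before M e) (before N e)"
    using that unfolding cyclically_decreasing_def
  proof (elim disjE conjE)
    assume "before N e \<subset> before M e" "before M e \<subset> before L e"
    then show ?thesis using decreasing_imp_rotates[OF L M N e] by blast
  next
    assume "before L e \<subset> before N e" "before N e \<subset> before M e"
    then obtain x y where "rotates M N L x y e" using decreasing_imp_rotates[OF M N L e] by blast
    then show ?thesis using rotates_cycle by metis
  next
    assume "before M e \<subset> before L e" "before L e \<subset> before N e"
    then obtain x y where "rotates N L M x y e" using decreasing_imp_rotates[OF N L M e] by blast
    then show ?thesis using rotates_cycle by metis
  qed
  ultimately show ?thesis using True unfolding cut_order_def by blast
qed (simp add: cut_order_def, blast)

lemma circular_order_cuts: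
  assumes "X \<noteq> {}"
  shows "circular_order (cuts X R) (cut_order X R)"
proof -
  obtain e where e: "e \<in> X" using assms by blast
  note iff = cut_order_iff[OF e]
  show ?thesis
  proof (rule circular_orderI)
    show "cut_order X R \<subseteq> cuts X R \<times> cuts X R \<times> cuts X R" unfolding cut_order_def by blast
  next
    fix L M N assume "(L, M, N) \<in> cut_order X R"
    then show "(M, N, L) \<in> cut_order X R"
      unfolding iff using cyclically_decreasing_cycle by metis
  next
    fix L M N assume "(L, M, N) \<in> cut_order X R"
    then show "(M, L, N) \<notin> cut_order X R"
      unfolding iff cyclically_decreasing_def by blast
  next
    fix L M N Q assume "(L, M, N) \<in> cut_order X R" "(L, N, Q) \<in> cut_order X R"
    then show "(L, M, Q) \<in> cut_order X R"
      unfolding iff cyclically_decreasing_def by blast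
  next
    fix L M N assume L: "L \<in> cuts X R" and M: "M \<in> cuts X R" and N: "N \<in> cuts X R"
      and ne: "L \<noteq> M" "M \<noteq> N" "L \<noteq> N"
    have "before L e \<subset> before M e \<or> before M e \<subset> before L e"
      "before M e \<subset> before N e \<or> before N e \<subset> before M e"
      "before L e \<subset> before N e \<or> before N e \<subset> before L e"
      using before_chain[OF L M e] before_chain[OF M N e] before_chain[OF L N e]
        before_inj[OF L M e] before_inj[OF M N e] before_inj[OF L N e] ne by blast+
    then show "(L, M, N) \<in> cut_order X R \<or> (L, N, M) \<in> cut_order X R"
      unfolding iff using cyclically_decreasing_total L M N by blast
  qed
qed

end

subsection \<open>Compactness of the space of cuts\<close>

text \<open>Tychonoff's theorem for a power of the discrete two-point space. Relations are
  represented by predicates here because function types carry the product topology.\<close>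

lemma compact_UNIV_predicates: "compact (UNIV :: ('b \<Rightarrow> bool) set)"
proof -
  have "compact_space (euclidean :: bool topology)"
    by (simp add: compact_space_def finite_imp_compact)
  then have "compact_space (product_topology (\<lambda>_ :: 'b. euclidean :: bool topology) UNIV)"
    by (simp add: compact_space_product_topology)
  then show ?thesis by (simp add: euclidean_product_topology compact_space_def)
qed

lemma open_predicates_at: "open {f :: 'b \<Rightarrow> bool. f p}"
  and closed_predicates_at: "closed {f :: 'b \<Rightarrow> bool. f p}"
proof -
  have eq: "{f :: 'b \<Rightarrow> bool. f p} = (\<lambda>f. f p) -` {True}" by blast
  show "open {f :: 'b \<Rightarrow> bool. f p}"
    unfolding eq by (rule open_vimage) (simp_all add: open_discrete)
  show "closed {f :: 'b \<Rightarrow> bool. f p}"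
    unfolding eq by (rule closed_vimage) simp_all
qed

text \<open>Each instance of a cut axiom involves at most three values of \<open>f\<close>, hence is
  a clopen condition; an intersection of such conditions is closed.\<close>

lemma closed_cuts: "closed {f. Collect f \<in> cuts X R}"
proof -
  have "{f. Collect f \<in> cuts X R} =
    {f. \<forall>x y z. (f (x, y) \<longrightarrow> x \<in> X \<and> y \<in> X) \<and> \<not> f (x, x) \<and>
      (f (x, y) \<and> f (y, z) \<longrightarrow> f (x, z) \<and> (x, y, z) \<in> R) \<and>
      (x \<in> X \<and> y \<in> X \<and> x \<noteq> y \<longrightarrow> f (x, y) \<or> f (y, x))}" (is "?L = ?R")
  proof (rule Collect_cong, rule iffI, goal_cases)
    case (1 f)
    then show ?case
      using cut_carrier[OF 1] cut_irrefl[OF 1] cut_trans[OF 1] cut_compatible[OF 1] cut_total[OF 1]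
      unfolding mem_Collect_eq by blast
  next
    case (2 f)
    show ?case
    proof (rule cutsI)
      show "Collect f \<subseteq> X \<times> X" by (rule subrelI) (use 2 in blast)
    qed (use 2 in blast)+
  qed
  also have "closed \<dots>"
    by (intro closed_Collect_all closed_Collect_conj closed_Collect_imp closed_Collect_disj
        closed_Collect_const open_Collect_conj open_Collect_const closed_Collect_neg
        open_predicates_at closed_predicates_at)
  finally show ?thesis .
qed

context circularly_ordered
begin

text \<open>A subbasic open set of the circular topology is described by membership of finitely
  many pairs, so the circular topology on cuts is coarser than the topology of pointwise
  convergence.\<close>

lemma open_cuts_arc:
  assumes X: "X \<noteq> {}" and U: "U \<in> circular_base (cuts X R) (cut_order X R)"
  shows "\<exists>V. open V \<and> {f. Collect f \<in> U} = {f. Collect f \<in> cuts X R} \<inter> V"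
proof (cases "U = cuts X R")
  case True
  then show ?thesis by (intro exI[of _ UNIV]) simp
next
  case False
  interpret C: circularly_ordered "cuts X R" "cut_order X R"
    by unfold_locales (rule circular_order_cuts[OF X])
  obtain L M where L: "L \<in> cuts X R" and M: "M \<in> cuts X R"
    and U: "U = cuts X R - closed_arc (cut_order X R) L M"
    using U False unfolding circular_base_def by blast
  show ?thesis
  proof (cases "L = M")
    case True
    \<comment> \<open>The arc from \<open>L\<close> to itself is the single point \<open>L\<close>,
      and a cut other than \<open>L\<close> disagrees with it at some pair.\<close>
    let ?V = "{f. \<exists>p. f p \<and> p \<notin> L \<or> \<not> f p \<and> p \<in> L}"
    have "open ?V"
      by (intro open_Collect_ex open_Collect_conj open_Collect_disj open_Collect_neg
          open_Collect_const open_predicates_at closed_predicates_at)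
    moreover have "{f. Collect f \<in> U} = {f. Collect f \<in> cuts X R} \<inter> ?V"
      unfolding U True[symmetric] C.closed_arc_self by auto
    ultimately show ?thesis by blast
  next
    case False
    \<comment> \<open>By \<open>not_between_iff\<close>, lying outside the arc means coming third
      after \<open>L\<close> and \<open>M\<close>. For fixed witnesses, \<open>rotates\<close> then
      asks only two pairs of the new cut.\<close>
    let ?V = "{f. \<exists>x y z. ((x, y) \<in> L \<and> (y, z) \<in> L \<and> (y, z) \<in> M \<and> (z, x) \<in> M) \<and>
      f (z, x) \<and> f (x, y)}"
    have "open ?V"
      by (intro open_Collect_ex open_Collect_conj open_Collect_const open_predicates_at)
    moreover have "Collect f \<in> U \<longleftrightarrow> Collect f \<in> cuts X R \<and> f \<in> ?V" for f
    proof -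
      have "Collect f \<in> U \<longleftrightarrow> Collect f \<in> cuts X R \<and> (L, M, Collect f) \<in> cut_order X R"
        unfolding U using C.not_between_iff[OF L M _ False] by blast
      also have "\<dots> \<longleftrightarrow> Collect f \<in> cuts X R \<and> (\<exists>x y z. rotates L M (Collect f) x y z)"
        unfolding cut_order_def using L M by simp
      also have "\<dots> \<longleftrightarrow> Collect f \<in> cuts X R \<and> f \<in> ?V"
        unfolding rotates_def by simp
      finally show ?thesis .
    qed
    then have "{f. Collect f \<in> U} = {f. Collect f \<in> cuts X R} \<inter> ?V" by blast
    ultimately show ?thesis by blast
  qed
qed

text \<open>The space of cuts is the image of a closed set of predicates under
  \<open>Collect\<close>, which is continuous because the circular topology is coarser than
  pointwise convergence.\<close>

lemma compact_space_cuts: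
  assumes "X \<noteq> {}"
  shows "compact_space (circular_topology (cuts X R) (cut_order X R))"
proof -
  let ?S = "{f. Collect f \<in> cuts X R}"
  have "compact ?S"
    using closed_Int_compact[OF closed_cuts compact_UNIV_predicates] by simp
  then have "compactin (top_of_set ?S) ?S" by (simp add: compactin_subtopology)
  moreover have "continuous_map (top_of_set ?S) (circular_topology (cuts X R) (cut_order X R)) Collect"
    unfolding circular_topology_def
  proof (rule continuous_on_generated_topo)
    fix U assume "U \<in> circular_base (cuts X R) (cut_order X R)"
    then obtain V where V: "open V" "{f. Collect f \<in> U} = ?S \<inter> V"
      using open_cuts_arc[OF assms] by blast
    then have "Collect -` U \<inter> topspace (top_of_set ?S) = ?S \<inter> V" by (auto simp: vimage_def)
    then show "openin (top_of_set ?S) (Collect -` U \<inter> topspace (top_of_set ?S))"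
      using openin_open_Int[OF V(1), of ?S] by simp
  qed (auto simp: circular_base_def)
  ultimately have "compactin (circular_topology (cuts X R) (cut_order X R)) (Collect ` ?S)"
    by (rule image_compactin)
  moreover have "Collect ` ?S = cuts X R"
  proof (rule equalityI; rule subsetI)
    fix L assume "L \<in> cuts X R"
    then show "L \<in> Collect ` ?S" by (intro image_eqI[of _ _ "\<lambda>p. p \<in> L"]) simp_all
  qed blast
  ultimately show ?thesis by (simp add: compact_space_def)
qed

lemma compact_circularly_ordered_space_cuts:
  assumes "X \<noteq> {}"
  shows "compact_circularly_ordered_space (cuts X R) (cut_order X R)"
  unfolding compact_circularly_ordered_space_def
  using circular_order_cuts[OF assms] compact_space_cuts[OF assms] by blast

section \<open>The two cuts at a point and open sets of cuts\<close>

definition first_cut :: "'a \<Rightarrow> ('a \<times> 'a) set" where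
  "first_cut e = {(x, y). x = e \<and> y \<in> X \<and> y \<noteq> e \<or> (e, x, y) \<in> R}"

definition last_cut :: "'a \<Rightarrow> ('a \<times> 'a) set" where
  "last_cut e = {(x, y). y = e \<and> x \<in> X \<and> x \<noteq> e \<or> (e, x, y) \<in> R}"

lemma trans_cut:
  assumes "(e, x, y) \<in> R" "(e, y, z) \<in> R"
  shows "(x, y, z) \<in> R"
  using cyclic[OF trans[OF cyclic[OF assms(2)] cyclic[OF cyclic[OF assms(1)]]]]
    cyclic by blast

lemma first_cut_in_cuts:
  assumes e: "e \<in> X"
  shows "first_cut e \<in> cuts X R"
proof (rule cutsI)
  show "first_cut e \<subseteq> X \<times> X" unfolding first_cut_def using carrier e by blast
  show "(x, x) \<notin> first_cut e" for x unfolding first_cut_def using distinct(2) by blast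
  show "(x, z) \<in> first_cut e" if "(x, y) \<in> first_cut e" "(y, z) \<in> first_cut e" for x y z
    using that trans[of e x y z] distinct(3)[of e x y] distinct(3)[of e y z] carrier(3)[of e y z]
    unfolding first_cut_def by blast
  show "(x, y, z) \<in> R" if "(x, y) \<in> first_cut e" "(y, z) \<in> first_cut e" for x y z
    using that trans_cut[of e x y z] distinct(3)[of e x y] unfolding first_cut_def by blast
  show "(x, y) \<in> first_cut e \<or> (y, x) \<in> first_cut e" if "x \<in> X" "y \<in> X" "x \<noteq> y" for x y
    using that total[OF e, of x y] unfolding first_cut_def by blast
qed

lemma last_cut_in_cuts:
  assumes e: "e \<in> X"
  shows "last_cut e \<in> cuts X R"
proof (rule cutsI)
  show "last_cut e \<subseteq> X \<times> X" unfolding last_cut_def using carrier e by blast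
  show "(x, x) \<notin> last_cut e" for x unfolding last_cut_def using distinct(2) by blast
  show "(x, z) \<in> last_cut e" if "(x, y) \<in> last_cut e" "(y, z) \<in> last_cut e" for x y z
    using that trans[of e x y z] distinct(1)[of e x y] distinct(1)[of e y z] carrier(2)[of e x y]
    unfolding last_cut_def by blast
  show "(x, y, z) \<in> R" if "(x, y) \<in> last_cut e" "(y, z) \<in> last_cut e" for x y z
    using that trans_cut[of e x y z] distinct(1)[of e y z] cyclic[of e x y]
    unfolding last_cut_def by blast
  show "(x, y) \<in> last_cut e \<or> (y, x) \<in> last_cut e" if "x \<in> X" "y \<in> X" "x \<noteq> y" for x y
    using that total[OF e, of x y] unfolding last_cut_def by blast
qed

text \<open>A cut puts \<open>b\<close> before \<open>a\<close> exactly when it lies on the closed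
  arc from the cut just after \<open>a\<close> to the cut just before \<open>b\<close>. The set in
  question is the complement of this arc, hence basic open. Positions are measured from the base
  point \<open>a\<close>.\<close>

lemma openin_cuts_less:
  assumes a: "a \<in> X" and b: "b \<in> X" and ne: "a \<noteq> b"
  shows "openin (circular_topology (cuts X R) (cut_order X R)) {L \<in> cuts X R. (a, b) \<in> L}"
proof -
  let ?P = "last_cut a" and ?Q = "first_cut b"
  have P: "?P \<in> cuts X R" and Q: "?Q \<in> cuts X R"
    using last_cut_in_cuts[OF a] first_cut_in_cuts[OF b] .
  have beforeP: "before ?P a = X - {a}"
    unfolding before_def last_cut_def using distinct(3) by blast
  have beforeQ: "before ?Q a = insert b {x. (b, x, a) \<in> R}"
    unfolding before_def first_cut_def using a ne by blast
  have arc: "L \<in> closed_arc (cut_order X R) ?P ?Q \<longleftrightarrow> b \<in> before L a" if L: "L \<in> cuts X R" for L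
  proof
    assume "L \<in> closed_arc (cut_order X R) ?P ?Q"
    then consider "L = ?P" | "L = ?Q" | "(?P, L, ?Q) \<in> cut_order X R"
      unfolding closed_arc_def open_arc_def by blast
    then show "b \<in> before L a"
    proof cases
      case 1
      then show ?thesis using beforeP b ne by blast
    next
      case 2
      then show ?thesis using beforeQ by blast
    next
      case 3
      then have "cyclically_decreasing (X - {a}) (before L a) (before ?Q a)"
        unfolding cut_order_iff[OF a] beforeP by blast
      then have "before ?Q a \<subset> before L a"
        unfolding cyclically_decreasing_def using before_subset[OF L] before_subset[OF Q] by blast
      then show ?thesis using beforeQ by blast
    qed
  next
    assume bL: "b \<in> before L a"
    have "before ?Q a \<subseteq> before L a"
    proof
      fix x assume "x \<in> before ?Q a"
      then consider "x = b" | "(a, b, x) \<in> R" unfolding beforeQ using cyclic by blast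
      then show "x \<in> before L a" using bL before_upward_closed[OF L bL] by cases blast+
    qed
    moreover have "before L a \<subseteq> before ?P a" using before_subset[OF L] beforeP by blast
    \<comment> \<open>By \<open>before_inj\<close>, equality of segments at \<open>a\<close> makes
      \<open>L\<close> an endpoint of the arc; otherwise both inclusions are strict.\<close>
    ultimately have "L = ?P \<or> L = ?Q \<or> before ?Q a \<subset> before L a \<and> before L a \<subset> before ?P a"
      using before_inj[OF L P a] before_inj[OF L Q a] by blast
    then show "L \<in> closed_arc (cut_order X R) ?P ?Q"
      unfolding closed_arc_def open_arc_def mem_Collect_eq cut_order_iff[OF a]
        cyclically_decreasing_def using L P Q by blast
  qed
  have "(a, b) \<in> L \<longleftrightarrow> L \<notin> closed_arc (cut_order X R) ?P ?Q" if L: "L \<in> cuts X R" for L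
    unfolding arc[OF L] before_def mem_Collect_eq
    using cut_total[OF L a b ne] cut_asym[OF L] by blast
  then have "{L \<in> cuts X R. (a, b) \<in> L} = cuts X R - closed_arc (cut_order X R) ?P ?Q"
    by blast
  then have "{L \<in> cuts X R. (a, b) \<in> L} \<in> circular_base (cuts X R) (cut_order X R)"
    unfolding circular_base_def using P Q by blast
  then show ?thesis
    unfolding circular_topology_def by (rule topology_generated_by_Basis)
qed

text \<open>Away from \<open>e\<close> both cuts follow \<open>R\<close> read from \<open>e\<close>,
  so a pair they order oppositely must involve \<open>e\<close>, which is the smaller element in the
  first cut.\<close>

lemma first_last_cut_separate:
  assumes "(x, y) \<in> first_cut e" "(y, x) \<in> last_cut e"
  shows "x = e"
  using assms asym cyclic unfolding first_cut_def last_cut_def by blast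

end

subsection \<open>The action on cuts\<close>

text \<open>An order isomorphism pulls closed arcs back to closed arcs, hence generating open sets
  back to generating open sets. Applied to the inverse as well, this makes it a
  homeomorphism.\<close>

lemma continuous_map_circular_topology:
  assumes f: "bij_betw f K K'"
    and pres: "\<And>x y z. x \<in> K \<Longrightarrow> y \<in> K \<Longrightarrow> z \<in> K \<Longrightarrow> (x, y, z) \<in> R \<longleftrightarrow> (f x, f y, f z) \<in> R'"
  shows "continuous_map (circular_topology K R) (circular_topology K' R') f"
  unfolding circular_topology_def[of K']
proof (rule continuous_on_generated_topo)
  have img: "f ` K = K'" and inj: "inj_on f K" using f unfolding bij_betw_def by blast+
  fix U assume "U \<in> circular_base K' R'"
  then consider "U = K'" | a b where "a \<in> K'" "b \<in> K'" "U = K' - closed_arc R' a b"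
    unfolding circular_base_def by blast
  then have "f -` U \<inter> K \<in> circular_base K R"
  proof cases
    case 1
    then have "f -` U \<inter> K = K" using img by blast
    then show ?thesis unfolding circular_base_def by blast
  next
    case 2
    then obtain a' b' where ab: "a' \<in> K" "b' \<in> K" "a = f a'" "b = f b'" using img by blast
    have "f x \<in> closed_arc R' a b \<longleftrightarrow> x \<in> closed_arc R a' b'" if "x \<in> K" for x
      unfolding closed_arc_def open_arc_def ab(3,4)
      using pres[OF ab(1) that ab(2)] inj_on_eq_iff[OF inj that ab(1)] inj_on_eq_iff[OF inj that ab(2)]
      by blast
    then have "f -` U \<inter> K = K - closed_arc R a' b'" using 2(3) img by blast
    then show ?thesis unfolding circular_base_def using ab by blast
  qed
  then have "openin (circular_topology K R) (f -` U \<inter> K)"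
    unfolding circular_topology_def by (rule topology_generated_by_Basis)
  then show "openin (circular_topology K R) (f -` U \<inter> topspace (circular_topology K R))"
    by simp
next
  show "f ` topspace (circular_topology K R) \<subseteq> \<Union>(circular_base K' R')"
    using f unfolding bij_betw_def circular_base_def by auto
qed

lemma homeomorphic_map_circular_topology:
  assumes f: "bij_betw f K K'"
    and pres: "\<And>x y z. x \<in> K \<Longrightarrow> y \<in> K \<Longrightarrow> z \<in> K \<Longrightarrow> (x, y, z) \<in> R \<longleftrightarrow> (f x, f y, f z) \<in> R'"
  shows "homeomorphic_map (circular_topology K R) (circular_topology K' R') f"
proof -
  let ?g = "inv_into K f"
  have g: "bij_betw ?g K' K" using f by (rule bij_betw_inv_into)
  have fg: "f (?g y) = y" if "y \<in> K'" for y using f that by (rule bij_betw_inv_into_right)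
  have gf: "?g (f x) = x" if "x \<in> K" for x using f that by (rule bij_betw_inv_into_left)
  have gK: "?g y \<in> K" if "y \<in> K'" for y using g that by (rule bij_betwE[rule_format])
  have "(x, y, z) \<in> R' \<longleftrightarrow> (?g x, ?g y, ?g z) \<in> R" if "x \<in> K'" "y \<in> K'" "z \<in> K'" for x y z
    using pres[OF gK[OF that(1)] gK[OF that(2)] gK[OF that(3)]] fg[OF that(1)] fg[OF that(2)]
      fg[OF that(3)] by simp
  then have "continuous_map (circular_topology K' R') (circular_topology K R) ?g"
    by (rule continuous_map_circular_topology[OF g])
  moreover have "continuous_map (circular_topology K R) (circular_topology K' R') f"
    using f pres by (rule continuous_map_circular_topology)
  ultimately show ?thesis
    unfolding homeomorphic_map_maps homeomorphic_maps_def using fg gf by (intro exI[of _ ?g]) simp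
qed

text \<open>The isolating neighbourhoods make every singleton open in the image, so the subspace
  topology there is discrete.\<close>

lemma embedding_map_discrete_topology:
  assumes f: "inj_on f A" "f ` A \<subseteq> topspace Y"
    and sep: "\<And>a. a \<in> A \<Longrightarrow> \<exists>U. openin Y U \<and> f a \<in> U \<and> (\<forall>b\<in>A. f b \<in> U \<longrightarrow> b = a)"
  shows "embedding_map (discrete_topology A) Y f"
proof -
  have "openin (subtopology Y (f ` A)) {y}" if y: "y \<in> f ` A" for y
  proof -
    obtain a where a: "y = f a" "a \<in> A" using y by (rule imageE)
    obtain U where U: "openin Y U" "f a \<in> U" "\<forall>b\<in>A. f b \<in> U \<longrightarrow> b = a" using sep[OF a(2)] by blast
    then have "{y} = U \<inter> f ` A" using a by blast
    then show ?thesis using U(1) unfolding openin_subtopology by blast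
  qed
  then have "discrete_topology (f ` A) = subtopology Y (f ` A)"
    unfolding discrete_topology_unique using f(2) by (simp add: inf.absorb2)
  moreover have "homeomorphic_map (discrete_topology A) (discrete_topology (f ` A)) f"
    by (rule bijective_open_imp_homeomorphic_map) (use f in \<open>auto simp: open_map_def\<close>)
  ultimately show ?thesis unfolding embedding_map_def by simp
qed

lemma topological_group_discrete_topology:
  assumes "group G"
  shows "topological_group G (discrete_topology (carrier G))"
proof -
  interpret group G by (rule assms)
  show ?thesis
    unfolding topological_group_def prod_topology_discrete_topology[symmetric] using assms by auto
qed

definition translate :: "('a, 'b) monoid_scheme \<Rightarrow> 'a \<Rightarrow> ('a \<times> 'a) set \<Rightarrow> ('a \<times> 'a) set" where
  "translate G g L = (\<lambda>(x, y). (g \<otimes>\<^bsub>G\<^esub> x, g \<otimes>\<^bsub>G\<^esub> y)) ` L"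

section \<open>Translation of cuts by group elements\<close>

locale left_circularly_ordered_group = G: group G + circularly_ordered "carrier G" R
  for G :: "('a, 'b) monoid_scheme" and R +
  assumes left_invariant: "g \<in> carrier G \<Longrightarrow> (x, y, z) \<in> R \<Longrightarrow>
    (g \<otimes>\<^bsub>G\<^esub> x, g \<otimes>\<^bsub>G\<^esub> y, g \<otimes>\<^bsub>G\<^esub> z) \<in> R"
begin

abbreviation "K \<equiv> cuts (carrier G) R"
abbreviation "S \<equiv> cut_order (carrier G) R"

lemma left_cancel:
  assumes "g \<in> carrier G" "x \<in> carrier G" "y \<in> carrier G"
  shows "g \<otimes>\<^bsub>G\<^esub> x = g \<otimes>\<^bsub>G\<^esub> y \<longleftrightarrow> x = y"
  using assms by (simp add: G.Units_eq)

lemma translate_memI: "(x, y) \<in> L \<Longrightarrow> (g \<otimes>\<^bsub>G\<^esub> x, g \<otimes>\<^bsub>G\<^esub> y) \<in> translate G g L"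
  unfolding translate_def by (auto intro: rev_image_eqI)

lemma translate_memE:
  assumes "p \<in> translate G g L"
  obtains x y where "p = (g \<otimes>\<^bsub>G\<^esub> x, g \<otimes>\<^bsub>G\<^esub> y)" "(x, y) \<in> L"
  using assms unfolding translate_def by auto

lemma translate_in_cuts:
  assumes g: "g \<in> carrier G" and L: "L \<in> K"
  shows "translate G g L \<in> K"
proof (rule cutsI)
  note c = cut_carrier[OF L]
  \<comment> \<open>Two translated pairs with a common middle entry come from pairs of
    \<open>L\<close> whose middle entries agree only after left cancellation.\<close>
  have middle: "y = y'" if "g \<otimes>\<^bsub>G\<^esub> y = g \<otimes>\<^bsub>G\<^esub> y'" "(x, y) \<in> L" "(y', z) \<in> L" for x y y' z
    using that left_cancel[of g y y'] g c by blast
  show "translate G g L \<subseteq> carrier G \<times> carrier G"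
    using g c by (blast elim: translate_memE)
  show "(x, x) \<notin> translate G g L" for x
  proof
    assume "(x, x) \<in> translate G g L"
    then obtain u v where "g \<otimes>\<^bsub>G\<^esub> u = g \<otimes>\<^bsub>G\<^esub> v" "(u, v) \<in> L" by (auto elim: translate_memE)
    then show False using g c cut_irrefl[OF L] left_cancel[of g u v] by blast
  qed
  show "(x, z) \<in> translate G g L" if xy: "(x, y) \<in> translate G g L" and yz: "(y, z) \<in> translate G g L"
    for x y z
  proof -
    obtain u v where uv: "(x, y) = (g \<otimes>\<^bsub>G\<^esub> u, g \<otimes>\<^bsub>G\<^esub> v)" "(u, v) \<in> L"
      using xy by (rule translate_memE)
    obtain v' w where vw: "(y, z) = (g \<otimes>\<^bsub>G\<^esub> v', g \<otimes>\<^bsub>G\<^esub> w)" "(v', w) \<in> L"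
      using yz by (rule translate_memE)
    have "v = v'" using middle[OF _ uv(2) vw(2)] uv(1) vw(1) by simp
    then show ?thesis using uv vw cut_trans[OF L, of u v w] translate_memI by blast
  qed
  show "(x, y, z) \<in> R" if xy: "(x, y) \<in> translate G g L" and yz: "(y, z) \<in> translate G g L"
    for x y z
  proof -
    obtain u v where uv: "(x, y) = (g \<otimes>\<^bsub>G\<^esub> u, g \<otimes>\<^bsub>G\<^esub> v)" "(u, v) \<in> L"
      using xy by (rule translate_memE)
    obtain v' w where vw: "(y, z) = (g \<otimes>\<^bsub>G\<^esub> v', g \<otimes>\<^bsub>G\<^esub> w)" "(v', w) \<in> L"
      using yz by (rule translate_memE)
    have "v = v'" using middle[OF _ uv(2) vw(2)] uv(1) vw(1) by simp
    then show ?thesis using uv vw cut_compatible[OF L, of u v w] left_invariant[OF g] by blast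
  qed
  show "(x, y) \<in> translate G g L \<or> (y, x) \<in> translate G g L"
    if x: "x \<in> carrier G" and y: "y \<in> carrier G" and ne: "x \<noteq> y" for x y
  proof -
    let ?x = "inv\<^bsub>G\<^esub> g \<otimes>\<^bsub>G\<^esub> x" and ?y = "inv\<^bsub>G\<^esub> g \<otimes>\<^bsub>G\<^esub> y"
    have eq: "g \<otimes>\<^bsub>G\<^esub> ?x = x" "g \<otimes>\<^bsub>G\<^esub> ?y = y"
      using g x y by (simp_all add: G.m_assoc[symmetric])
    then have "?x \<noteq> ?y" using ne by metis
    then have "(?x, ?y) \<in> L \<or> (?y, ?x) \<in> L" using cut_total[OF L, of ?x ?y] g x y by simp
    then show ?thesis using translate_memI[of ?x ?y L g] translate_memI[of ?y ?x L g] eq by metis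
  qed
qed

lemma translate_mult:
  assumes "g \<in> carrier G" "h \<in> carrier G" "L \<in> K"
  shows "translate G (g \<otimes>\<^bsub>G\<^esub> h) L = translate G g (translate G h L)"
  unfolding translate_def image_image
  by (rule image_cong) (use assms cut_carrier[OF assms(3)] in \<open>auto simp: G.m_assoc\<close>)

lemma translate_one:
  assumes "L \<in> K"
  shows "translate G \<one>\<^bsub>G\<^esub> L = L"
proof -
  have "translate G \<one>\<^bsub>G\<^esub> L = (\<lambda>p. p) ` L"
    unfolding translate_def by (rule image_cong) (use cut_carrier[OF assms] in auto)
  then show ?thesis by simp
qed

lemma translate_inv:
  assumes "g \<in> carrier G" "L \<in> K"
  shows "translate G (inv\<^bsub>G\<^esub> g) (translate G g L) = L" "translate G g (translate G (inv\<^bsub>G\<^esub> g) L) = L"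
  using assms translate_mult[of "inv\<^bsub>G\<^esub> g" g L] translate_mult[of g "inv\<^bsub>G\<^esub> g" L]
    translate_one[OF assms(2)] by simp_all

lemma translate_cut_order_imp:
  assumes g: "g \<in> carrier G" and "(L, M, N) \<in> S"
  shows "(translate G g L, translate G g M, translate G g N) \<in> S"
proof -
  have K: "L \<in> K" "M \<in> K" "N \<in> K" using assms(2) unfolding cut_order_def by auto
  obtain x y z where "rotates L M N x y z" using assms(2) unfolding cut_order_def by auto
  then have "rotates (translate G g L) (translate G g M) (translate G g N)
      (g \<otimes>\<^bsub>G\<^esub> x) (g \<otimes>\<^bsub>G\<^esub> y) (g \<otimes>\<^bsub>G\<^esub> z)"
    unfolding rotates_def by (simp add: translate_memI)
  then show ?thesis
    unfolding cut_order_def using translate_in_cuts[OF g K(1)] translate_in_cuts[OF g K(2)]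
      translate_in_cuts[OF g K(3)] by blast
qed

lemma translate_cut_order:
  assumes g: "g \<in> carrier G" and K: "L \<in> K" "M \<in> K" "N \<in> K"
  shows "(L, M, N) \<in> S \<longleftrightarrow> (translate G g L, translate G g M, translate G g N) \<in> S"
  using translate_cut_order_imp[OF g, of L M N]
    translate_cut_order_imp[OF G.inv_closed[OF g], of "translate G g L" "translate G g M" "translate G g N"]
    translate_inv(1)[OF g K(1)] translate_inv(1)[OF g K(2)] translate_inv(1)[OF g K(3)]
  by metis

definition action :: "'a \<Rightarrow> ('a \<times> 'a) set \<Rightarrow> ('a \<times> 'a) set" where
  "action g = restrict (translate G g) K"

lemma bij_betw_action: "g \<in> carrier G \<Longrightarrow> bij_betw (action g) K K"
  by (rule bij_betw_byWitness[of _ "translate G (inv\<^bsub>G\<^esub> g)"])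
    (auto simp: action_def translate_inv translate_in_cuts)

lemma action_in_H_plus:
  assumes g: "g \<in> carrier G"
  shows "action g \<in> carrier (H_plus K S)"
proof -
  have pres: "(L, M, N) \<in> S \<longleftrightarrow> (action g L, action g M, action g N) \<in> S"
    if "L \<in> K" "M \<in> K" "N \<in> K" for L M N
    using translate_cut_order[OF g that] that unfolding action_def by simp
  have "homeomorphic_map (circular_topology K S) (circular_topology K S) (action g)"
    using bij_betw_action[OF g] pres by (rule homeomorphic_map_circular_topology)
  moreover have "action g \<in> Bij K"
    unfolding Bij_def using bij_betw_action[OF g] by (simp add: action_def)
  ultimately show ?thesis unfolding H_plus_def using pres by simp
qed

lemma action_hom: "action \<in> hom G (H_plus K S)"
proof (rule homI)
  show "action g \<in> carrier (H_plus K S)" if "g \<in> carrier G" for g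
    using action_in_H_plus[OF that] .
  fix g h assume g: "g \<in> carrier G" and h: "h \<in> carrier G"
  have Bij: "action k \<in> Bij K" if "k \<in> carrier G" for k
    using action_in_H_plus[OF that] unfolding H_plus_def by simp
  have "action (g \<otimes>\<^bsub>G\<^esub> h) = compose K (action g) (action h)"
    by (rule extensionalityI[of _ K])
      (simp_all add: action_def compose_def translate_mult translate_in_cuts g h)
  then show "action (g \<otimes>\<^bsub>G\<^esub> h) = action g \<otimes>\<^bsub>H_plus K S\<^esub> action h"
    using Bij[OF g] Bij[OF h] by (simp add: H_plus_def BijGroup_def)
qed

text \<open>Singletons are compact, so evaluating at one cut already gives subbasic sets of the
  compact-open topology.\<close>

lemma openin_H_plus_topology:
  assumes "openin (circular_topology K S) U" "L \<in> K"
  shows "openin (H_plus_topology K S) {f \<in> carrier (H_plus K S). f L \<in> U}"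
proof -
  let ?T = "circular_topology K S"
  let ?V = "{f \<in> extensional (topspace ?T). continuous_map ?T ?T f \<and> f ` {L} \<subseteq> U}"
  have "compactin ?T {L}" using assms(2) by simp
  then have "openin (compact_open_topology ?T ?T) ?V"
    unfolding compact_open_topology_def using assms(1) by (intro topology_generated_by_Basis) blast
  moreover have "{f \<in> carrier (H_plus K S). f L \<in> U} = ?V \<inter> carrier (H_plus K S)"
    by (auto simp: H_plus_def Bij_def homeomorphic_imp_continuous_map)
  ultimately show ?thesis unfolding H_plus_topology_def openin_subtopology by blast
qed

text \<open>Left translation by \<open>g\<close> is pinned down by the open condition that the two cuts at
  \<open>\<one>\<close> are sent to opposite sides of the pair \<open>g, g \<otimes> b\<close>, because those two
  cuts differ only in the position of \<open>\<one>\<close>.\<close>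

lemma action_isolated:
  assumes g: "g \<in> carrier G"
  shows "\<exists>U. openin (H_plus_topology K S) U \<and> action g \<in> U \<and>
    (\<forall>h\<in>carrier G. action h \<in> U \<longrightarrow> h = g)"
proof (cases "carrier G = {\<one>\<^bsub>G\<^esub>}")
  case True
  then have "\<forall>h\<in>carrier G. h = g" using g by auto
  moreover have "openin (H_plus_topology K S) (carrier (H_plus K S))"
    using openin_topspace[of "H_plus_topology K S"] unfolding topspace_H_plus_topology .
  ultimately show ?thesis
    using action_in_H_plus[OF g] by (intro exI[of _ "carrier (H_plus K S)"] conjI) simp_all
next
  case False
  then obtain b where b: "b \<in> carrier G" "b \<noteq> \<one>\<^bsub>G\<^esub>" using G.one_closed by blast
  let ?P = "first_cut \<one>\<^bsub>G\<^esub>" and ?Q = "last_cut \<one>\<^bsub>G\<^esub>"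
  let ?gb = "g \<otimes>\<^bsub>G\<^esub> b"
  have P: "?P \<in> K" and Q: "?Q \<in> K"
    using first_cut_in_cuts[OF G.one_closed] last_cut_in_cuts[OF G.one_closed] .
  have gb: "?gb \<in> carrier G" "g \<noteq> ?gb"
    using g b left_cancel[of g "\<one>\<^bsub>G\<^esub>" b] by (simp, metis G.one_closed G.r_one)
  let ?U = "{f \<in> carrier (H_plus K S). f ?P \<in> {L \<in> K. (g, ?gb) \<in> L}} \<inter>
    {f \<in> carrier (H_plus K S). f ?Q \<in> {L \<in> K. (?gb, g) \<in> L}}"
  have "openin (H_plus_topology K S) ?U"
    using openin_H_plus_topology[OF openin_cuts_less[OF g gb] P]
      openin_H_plus_topology[OF openin_cuts_less[OF gb(1) g gb(2)[symmetric]] Q]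
    by (rule openin_Int)
  moreover have "action g \<in> ?U"
  proof -
    have "(\<one>\<^bsub>G\<^esub>, b) \<in> ?P" "(b, \<one>\<^bsub>G\<^esub>) \<in> ?Q" unfolding first_cut_def last_cut_def using b by auto
    then have "(g, ?gb) \<in> translate G g ?P" "(?gb, g) \<in> translate G g ?Q"
      using translate_memI[of "\<one>\<^bsub>G\<^esub>" b ?P g] translate_memI[of b "\<one>\<^bsub>G\<^esub>" ?Q g] g by simp_all
    then show ?thesis
      using action_in_H_plus[OF g] translate_in_cuts[OF g P] translate_in_cuts[OF g Q] P Q
      unfolding action_def by simp
  qed
  moreover have "h = g" if h: "h \<in> carrier G" and "action h \<in> ?U" for h
  proof -
    have p: "(g, ?gb) \<in> translate G h ?P" and q: "(?gb, g) \<in> translate G h ?Q"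
      using that(2) P Q unfolding action_def by simp_all
    obtain x y where xy: "(g, ?gb) = (h \<otimes>\<^bsub>G\<^esub> x, h \<otimes>\<^bsub>G\<^esub> y)" "(x, y) \<in> ?P"
      using p by (rule translate_memE)
    obtain y' x' where yx: "(?gb, g) = (h \<otimes>\<^bsub>G\<^esub> y', h \<otimes>\<^bsub>G\<^esub> x')" "(y', x') \<in> ?Q"
      using q by (rule translate_memE)
    \<comment> \<open>Pulled back along \<open>h\<close>, both memberships concern the same pair,
      which the two cuts at the identity order oppositely. So \<open>x\<close> is the identity and
      \<open>g\<close>, being \<open>h\<close> times \<open>x\<close>, equals
      \<open>h\<close>.\<close>
    have "h \<otimes>\<^bsub>G\<^esub> x = h \<otimes>\<^bsub>G\<^esub> x'" "h \<otimes>\<^bsub>G\<^esub> y = h \<otimes>\<^bsub>G\<^esub> y'"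
      using xy(1) yx(1) by (metis Pair_inject)+
    then have "x = x'" "y = y'"
      using left_cancel[OF h cut_carrier(1)[OF P xy(2)] cut_carrier(2)[OF Q yx(2)]]
        left_cancel[OF h cut_carrier(2)[OF P xy(2)] cut_carrier(1)[OF Q yx(2)]] by blast+
    then have "x = \<one>\<^bsub>G\<^esub>" using first_last_cut_separate[OF xy(2)] yx(2) by blast
    then show ?thesis using xy(1) h by simp
  qed
  ultimately show ?thesis by blast
qed

lemma c_orderly_discrete_topology:
  "c_orderly TYPE(('a \<times> 'a) set) G (discrete_topology (carrier G))"
proof -
  \<comment> \<open>Isolation contains injectivity: if two elements have equal actions, the set
    isolating one contains the action of the other.\<close>
  have inj: "inj_on action (carrier G)"
    using action_isolated by (intro inj_onI) metis
  have "embedding_map (discrete_topology (carrier G)) (H_plus_topology K S) action"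
    using inj action_in_H_plus action_isolated
    by (intro embedding_map_discrete_topology) (auto simp: topspace_H_plus_topology)
  moreover have "compact_circularly_ordered_space K S"
    using compact_circularly_ordered_space_cuts G.one_closed by blast
  ultimately show ?thesis
    unfolding c_orderly_def using inj action_hom topological_group_discrete_topology[OF G.is_group]
    by blast
qed

end

lemma c_orderly_if_left_circularly_orderable:
  fixes G :: "('a, 'b) monoid_scheme"
  assumes G: "group G" and "left_circularly_orderable G"
  shows "c_orderly TYPE(('a \<times> 'a) set) G (discrete_topology (carrier G))"
proof -
  obtain R where R: "circular_order (carrier G) R"
    and inv: "\<forall>g\<in>carrier G. \<forall>x\<in>carrier G. \<forall>y\<in>carrier G. \<forall>z\<in>carrier G.
           (x, y, z) \<in> R \<longleftrightarrow> (g \<otimes>\<^bsub>G\<^esub> x, g \<otimes>\<^bsub>G\<^esub> y, g \<otimes>\<^bsub>G\<^esub> z) \<in> R"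
    using assms(2) unfolding left_circularly_orderable_def by blast
  interpret C: circularly_ordered "carrier G" R using R by unfold_locales
  interpret group G by (rule G)
  interpret left_circularly_ordered_group G R
  proof
    fix g x y z assume "g \<in> carrier G" "(x, y, z) \<in> R"
    then show "(g \<otimes>\<^bsub>G\<^esub> x, g \<otimes>\<^bsub>G\<^esub> y, g \<otimes>\<^bsub>G\<^esub> z) \<in> R"
      using inv C.carrier[of x y z] by blast
  qed
  show ?thesis by (rule c_orderly_discrete_topology)
qed

text \<open>The points of the space of cuts are sets of pairs of group elements, which fixes the
  type in the equivalence. The second conjunct lets the points come from any type
  \<open>'k\<close>.\<close>

theorem theoremA:
  fixes G :: "('a, 'b) monoid_scheme"
  assumes "group G"
  shows "(left_circularly_orderable G \<longleftrightarrow>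
            c_orderly TYPE(('a \<times> 'a) set) G (discrete_topology (carrier G))) \<and>
         (c_orderly TYPE('k) G (discrete_topology (carrier G)) \<longrightarrow>
            left_circularly_orderable G)"
  by (intro conjI iffI impI)
    (erule c_orderly_if_left_circularly_orderable[OF assms],
     (erule left_circularly_orderable_if_c_orderly[OF assms])+)

end
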